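(* Let $\Gamma$ be an infinite, finitely generated, fully residually free group, $\Delta$ a finite index, normal subgroup of $\Gamma$, and $p\in\mathbb{N}$ a prime. Then there exist an integral domain $R\subset\mathbb{C}$, an ideal $\mathfrak{m}\subset R$ with $R/\mathfrak{m}=\mathbf{F}_p$, and a faithful homomorphism $\rho\colon\Gamma\to\mathrm{SL}(n_\Delta,R)$ such that $\Delta=\ker(r_{\mathfrak{m}}\circ\rho)$, where $r_{\mathfrak{m}}\colon\mathrm{SL}(n_\Delta,R)\to\mathrm{SL}(n_\Delta,\mathbf{F}_p)$ is the reduction modulo $\mathfrak{m}$ homomorphism and $n_\Delta=2[\Gamma:\Delta]$.
   Context: $\mathbf{F}_p$ is the field of order $p$, and a faithful homomorphism is an injective one. A group $\Gamma$ is fully residually free if for each finite subset $S\subset\Gamma$ of non-trivial elements, there exist $r_S\in\mathbb{N}$ and a homomorphism $\psi_S\colon\Gamma\to F_{r_S}$ to the free group of rank $r_S$ such that the restriction of $\psi_S$ to $S$ is injective. *)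

theory Defs
  imports
    "HOL-Algebra.Generated_Groups"
    "HOL-Algebra.Subrings"
    "HOL-Algebra.QuotRing"
    "HOL-Number_Theory.Residues"
    "Jordan_Normal_Form.VS_Connect"
begin

section \<open>Free groups and fully residually free groups\<close>

text \<open>
  The free group of rank \<open>r\<close> on the generators \<open>0, \<dots>, r - 1\<close> is realised by reduced words.
  The letter \<open>(i, True)\<close> is the \<open>i\<close>-th generator and \<open>(i, False)\<close> its inverse.
\<close>

definition inv_letter :: "nat \<times> bool \<Rightarrow> nat \<times> bool" where
  "inv_letter x = (fst x, \<not> snd x)"

definition reduced :: "(nat \<times> bool) list \<Rightarrow> bool" where
  "reduced w \<longleftrightarrow> successively (\<lambda>x y. y \<noteq> inv_letter x) w"

fun push :: "nat \<times> bool \<Rightarrow> (nat \<times> bool) list \<Rightarrow> (nat \<times> bool) list" where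
  "push x [] = [x]"
| "push x (y # w) = (if y = inv_letter x then w else x # y # w)"

text \<open>Folding \<^const>\<open>push\<close> concatenates two reduced words and cancels at the seam.\<close>

definition free_group :: "nat \<Rightarrow> (nat \<times> bool) list monoid" where
  "free_group r =
    \<lparr>carrier = {w. set w \<subseteq> {..<r} \<times> UNIV \<and> reduced w},
     monoid.mult = (\<lambda>u v. foldr push u v),
     one = []\<rparr>"

definition finitely_generated :: "('a, 'b) monoid_scheme \<Rightarrow> bool" where
  "finitely_generated G \<longleftrightarrow>
    (\<exists>S. finite S \<and> S \<subseteq> carrier G \<and> generate G S = carrier G)"

text \<open>
  The homomorphism is only required to be injective on \<open>S\<close>, so a singleton \<open>S\<close> imposes
  nothing; taking \<open>S\<close> of the form \<open>{h, g h}\<close> shows that in groups with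
  more than two elements no element \<open>g \<noteq> 1\<close> lies in the kernel of every homomorphism to a free group.
\<close>

definition fully_residually_free :: "('a, 'b) monoid_scheme \<Rightarrow> bool" where
  "fully_residually_free G \<longleftrightarrow>
    (\<forall>S. finite S \<and> S \<subseteq> carrier G - {\<one>\<^bsub>G\<^esub>} \<longrightarrow>
      (\<exists>r. \<exists>\<psi> \<in> hom G (free_group r). inj_on \<psi> S))"


section \<open>Special linear groups over ring records\<close>

text \<open>
  Both a subring of the complex numbers and the field \<open>\<int>/p\<int>\<close> are ring records here, so the
  determinant is given by the Leibniz formula over an arbitrary ring record. The matrix type
  itself is the one of \<open>Jordan_Normal_Form\<close>.
\<close>

definition ring_det :: "('a, 'b) ring_scheme \<Rightarrow> 'a mat \<Rightarrow> 'a" where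
  "ring_det R A =
    (\<Oplus>\<^bsub>R\<^esub>\<sigma>\<in>{\<sigma>. \<sigma> permutes {0..<dim_row A}}.
      [sign \<sigma>] \<cdot>\<^bsub>R\<^esub> (\<Otimes>\<^bsub>R\<^esub>i\<in>{0..<dim_row A}. A $$ (i, \<sigma> i)))"

definition SL :: "nat \<Rightarrow> ('a, 'b) ring_scheme \<Rightarrow> 'a mat monoid" where
  "SL n R =
    \<lparr>carrier = {A \<in> carrier_mat n n. elements_mat A \<subseteq> carrier R \<and> ring_det R A = \<one>\<^bsub>R\<^esub>},
     monoid.mult = (\<lambda>A B. mat n n (\<lambda>(i, j). \<Oplus>\<^bsub>R\<^esub>k\<in>{0..<n}. A $$ (i, k) \<otimes>\<^bsub>R\<^esub> B $$ (k, j))),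
     one = mat n n (\<lambda>(i, j). if i = j then \<one>\<^bsub>R\<^esub> else \<zero>\<^bsub>R\<^esub>)\<rparr>"

abbreviation complex_subring :: "complex set \<Rightarrow> complex ring" where
  "complex_subring R \<equiv> (class_ring :: complex ring)\<lparr>carrier := R\<rparr>"

text \<open>
  Entrywise reduction modulo the ideal \<open>m\<close> of \<open>R\<close>, where \<open>\<phi>\<close> is the identification of the
  quotient ring with the residue field (unique if that field is \<open>\<int>/p\<int>\<close>, which has no nontrivial
  automorphism).
\<close>

definition mat_reduction ::
    "('a, 'b) ring_scheme \<Rightarrow> 'a set \<Rightarrow> ('a set \<Rightarrow> 'c) \<Rightarrow> 'a mat \<Rightarrow> 'c mat" where
  "mat_reduction R m \<phi> = map_mat (\<lambda>a. \<phi> (m +>\<^bsub>R\<^esub> a))"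


section \<open>Consistency of the definitions\<close>

lemma inv_letter_inv_letter [simp]: "inv_letter (inv_letter x) = x"
  by (simp add: inv_letter_def)

lemma reduced_Nil [simp]: "reduced []"
  by (simp add: reduced_def)

lemma reduced_ConsD: "reduced (x # w) \<Longrightarrow> reduced w"
  by (cases w) (auto simp: reduced_def)

lemma reduced_push: "reduced w \<Longrightarrow> reduced (push x w)"
  by (cases w) (auto simp: reduced_def dest: reduced_ConsD[unfolded reduced_def])

lemma reduced_foldr_push: "reduced v \<Longrightarrow> reduced (foldr push u v)"
  by (induction u) (auto intro: reduced_push)

lemma push_inv_push: "reduced w \<Longrightarrow> push (inv_letter x) (push x w) = w"
proof (cases w)
  case (Cons y v)
  assume "reduced w"
  then show ?thesis using Cons
    by (cases v) (auto simp: reduced_def)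
qed auto

lemma push_push_inv: "reduced w \<Longrightarrow> push x (push (inv_letter x) w) = w"
  using push_inv_push[of w "inv_letter x"] by simp

lemma foldr_push_push:
  assumes "reduced w"
  shows "foldr push (push x v) w = push x (foldr push v w)"
  using assms by (cases v) (auto simp: push_push_inv reduced_foldr_push)

lemma foldr_push_assoc:
  assumes "reduced w"
  shows "foldr push (foldr push u v) w = foldr push u (foldr push v w)"
  by (induction u) (auto simp: foldr_push_push assms)

lemma foldr_push_Nil: "reduced w \<Longrightarrow> foldr push w [] = w"
proof (induction w)
  case (Cons x w)
  then show ?case
    by (cases w) (auto simp: reduced_def)
qed auto

lemma set_push: "set (push x w) \<subseteq> insert x (set w)"
  by (cases w) auto

lemma set_foldr_push: "set (foldr push u v) \<subseteq> set u \<union> set v"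
  by (induction u) (use set_push in fastforce)+

lemma foldr_push_inverse:
  "reduced w \<Longrightarrow> foldr push (map inv_letter (rev w)) w = []"
  by (induction w) (auto dest: reduced_ConsD)

lemma reduced_inverse: "reduced w \<Longrightarrow> reduced (map inv_letter (rev w))"
  unfolding reduced_def successively_map successively_rev
  by (erule successively_mono) auto

lemma group_free_group: "group (free_group r)"
proof (rule groupI)
  fix u v assume "u \<in> carrier (free_group r)" "v \<in> carrier (free_group r)"
  then show "u \<otimes>\<^bsub>free_group r\<^esub> v \<in> carrier (free_group r)"
    using set_foldr_push[of u v] by (auto simp: free_group_def reduced_foldr_push)
next
  fix w assume w: "w \<in> carrier (free_group r)"
  have "map inv_letter (rev w) \<in> carrier (free_group r)"
    using w by (auto simp: free_group_def reduced_inverse inv_letter_def)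
  with w show "\<exists>v\<in>carrier (free_group r). v \<otimes>\<^bsub>free_group r\<^esub> w = \<one>\<^bsub>free_group r\<^esub>"
    by (intro bexI[of _ "map inv_letter (rev w)"]) (auto simp: free_group_def foldr_push_inverse)
qed (auto simp: free_group_def foldr_push_assoc)

lemma hom_ring_det:
  assumes "ring_hom_cring R S h" and A: "A \<in> carrier_mat n n" "elements_mat A \<subseteq> carrier R"
  shows "ring_det S (map_mat h A) = h (ring_det R A)"
proof -
  interpret ring_hom_cring R S h by fact
  have entry: "A $$ (i, \<sigma> i) \<in> carrier R" if "\<sigma> permutes {0..<n}" "i < n" for \<sigma> i
    using A that permutes_in_image[OF that(1), of i] by (intro subsetD[OF A(2)] elements_matI[OF A(1)]) auto
  have prod: "(\<lambda>i. A $$ (i, \<sigma> i)) \<in> {0..<n} \<rightarrow> carrier R" if "\<sigma> permutes {0..<n}" for \<sigma>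
    using entry[OF that] by auto
  have pow: "h ([k] \<cdot>\<^bsub>R\<^esub> x) = [k] \<cdot>\<^bsub>S\<^esub> h x" if "x \<in> carrier R" for x and k :: int
    unfolding add_pow_def
    by (rule hom_int_pow) (use that in \<open>auto simp: hom_def R.add.group_axioms S.add.group_axioms\<close>)
  have "h (ring_det R A) =
      (\<Oplus>\<^bsub>S\<^esub>\<sigma>\<in>{\<sigma>. \<sigma> permutes {0..<n}}. h ([sign \<sigma>] \<cdot>\<^bsub>R\<^esub> (\<Otimes>\<^bsub>R\<^esub>i\<in>{0..<n}. A $$ (i, \<sigma> i))))"
    using A prod by (auto simp: ring_det_def o_def intro!: R.finprod_closed R.add.int_pow_closed
      [folded add_pow_def, simplified])
  also have "\<dots> = (\<Oplus>\<^bsub>S\<^esub>\<sigma>\<in>{\<sigma>. \<sigma> permutes {0..<n}}.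
      [sign \<sigma>] \<cdot>\<^bsub>S\<^esub> (\<Otimes>\<^bsub>S\<^esub>i\<in>{0..<n}. map_mat h A $$ (i, \<sigma> i)))"
  proof (rule S.finsum_cong'[OF refl], safe)
    fix \<sigma> :: "nat \<Rightarrow> nat" assume s: "\<sigma> permutes {0..<n}"
    have img: "\<sigma> i < n" if "i < n" for i
      using s permutes_in_image[of \<sigma> "{0..<n}" i] that by auto
    have "h (\<Otimes>\<^bsub>R\<^esub>i\<in>{0..<n}. A $$ (i, \<sigma> i)) = (\<Otimes>\<^bsub>S\<^esub>i\<in>{0..<n}. h (A $$ (i, \<sigma> i)))"
      using hom_finprod[OF prod[of \<sigma>]] s by (simp add: o_def)
    also have "\<dots> = (\<Otimes>\<^bsub>S\<^esub>i\<in>{0..<n}. map_mat h A $$ (i, \<sigma> i))"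
      by (rule S.finprod_cong') (use A img entry[of \<sigma>] s in auto)
    finally show "h ([sign \<sigma>] \<cdot>\<^bsub>R\<^esub> (\<Otimes>\<^bsub>R\<^esub>i\<in>{0..<n}. A $$ (i, \<sigma> i))) =
        [sign \<sigma>] \<cdot>\<^bsub>S\<^esub> (\<Otimes>\<^bsub>S\<^esub>i\<in>{0..<n}. map_mat h A $$ (i, \<sigma> i))"
      using pow prod[of \<sigma>] s by simp
    show "[sign \<sigma>] \<cdot>\<^bsub>S\<^esub> (\<Otimes>\<^bsub>S\<^esub>i\<in>{0..<n}. map_mat h A $$ (i, \<sigma> i)) \<in> carrier S"
      using A img entry[of \<sigma>] s
      by (auto intro!: S.finprod_closed S.add.int_pow_closed[folded add_pow_def, simplified])
  qed
  also have "\<dots> = ring_det S (map_mat h A)"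
    using A by (simp add: ring_det_def)
  finally show ?thesis ..
qed

lemma map_mat_hom_SL:
  assumes "ring_hom_cring R S h"
  shows "map_mat h \<in> hom (SL n R) (SL n S)"
proof (rule homI)
  interpret ring_hom_cring R S h by fact
  fix A assume A: "A \<in> carrier (SL n R)"
  then show "map_mat h A \<in> carrier (SL n S)"
    using hom_ring_det[OF assms, of A n] by (auto simp: SL_def elements_mat_def)
  fix B assume B: "B \<in> carrier (SL n R)"
  have el: "A $$ (i, j) \<in> carrier R" "B $$ (i, j) \<in> carrier R" if "i < n" "j < n" for i j
    using A B that elements_matI[of A n n i j] elements_matI[of B n n i j]
    by (simp_all add: SL_def subset_iff)
  show "map_mat h (A \<otimes>\<^bsub>SL n R\<^esub> B) = map_mat h A \<otimes>\<^bsub>SL n S\<^esub> map_mat h B"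
  proof (rule eq_matI)
    fix i j assume "i < dim_row (map_mat h A \<otimes>\<^bsub>SL n S\<^esub> map_mat h B)"
      "j < dim_col (map_mat h A \<otimes>\<^bsub>SL n S\<^esub> map_mat h B)"
    then have ij: "i < n" "j < n" by (auto simp: SL_def)
    have "h (\<Oplus>\<^bsub>R\<^esub>k\<in>{0..<n}. A $$ (i, k) \<otimes>\<^bsub>R\<^esub> B $$ (k, j)) =
        (\<Oplus>\<^bsub>S\<^esub>k\<in>{0..<n}. h (A $$ (i, k) \<otimes>\<^bsub>R\<^esub> B $$ (k, j)))"
      using el ij by (subst hom_finsum) (auto simp: o_def)
    also have "\<dots> = (\<Oplus>\<^bsub>S\<^esub>k\<in>{0..<n}. map_mat h A $$ (i, k) \<otimes>\<^bsub>S\<^esub> map_mat h B $$ (k, j))"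
      by (rule S.finsum_cong') (use A B el ij in \<open>auto simp: SL_def\<close>)
    finally show "map_mat h (A \<otimes>\<^bsub>SL n R\<^esub> B) $$ (i, j) =
        (map_mat h A \<otimes>\<^bsub>SL n S\<^esub> map_mat h B) $$ (i, j)"
      using ij by (simp add: SL_def)
  qed (auto simp: SL_def)
qed

lemma mat_reduction_hom:
  assumes "cring R" "ideal m R" "cring S" "\<phi> \<in> ring_iso (R Quot m) S"
  shows "mat_reduction R m \<phi> \<in> hom (SL n R) (SL n S)"
proof -
  have "(\<phi> \<circ> (+>\<^bsub>R\<^esub>) m) \<in> Ring.ring_hom R S"
    using ring_hom_trans[OF ideal.rcos_ring_hom[OF assms(2)]] assms(4)
    by (auto simp: ring_iso_def)
  then have "ring_hom_cring R S (\<phi> \<circ> (+>\<^bsub>R\<^esub>) m)"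
    using assms by (simp add: ring_hom_cring_def ring_hom_cring_axioms_def)
  from map_mat_hom_SL[OF this] show ?thesis
    by (simp add: mat_reduction_def o_def)
qed

text \<open>For subrings of the complex numbers, \<^const>\<open>SL\<close> uses the usual determinant and product.\<close>

lemma subdomain_complex_cring:
  assumes "subdomain R (class_ring :: complex ring)"
  shows "cring (complex_subring R)"
  using assms ring.subcring_iff[OF class_ring.ring_axioms, of R] by (auto simp: subdomain_def)

lemma complex_subring_id_hom:
  assumes "subdomain R (class_ring :: complex ring)"
  shows "ring_hom_cring (complex_subring R) class_ring id"
  using subdomain_complex_cring[OF assms] class_cring.cring_axioms
  by (auto simp: ring_hom_cring_def ring_hom_cring_axioms_def Ring.ring_hom_def)

lemma ring_det_class_ring:
  fixes A :: "complex mat"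
  assumes "A \<in> carrier_mat n n"
  shows "ring_det class_ring A = det A"
proof -
  have "[sign \<sigma>] \<cdot>\<^bsub>class_ring\<^esub> x = signof \<sigma> * x" for \<sigma> :: "nat \<Rightarrow> nat" and x :: complex
  proof (cases "sign \<sigma> = 1")
    case True
    then show ?thesis
      using class_ring.add.int_pow_1[of x] by (simp add: add_pow_def)
  next
    case False
    then have "sign \<sigma> = -1" by (simp add: sign_def split: if_splits)
    then show ?thesis
      using class_ring.add.int_pow_neg[of x 1] class_ring.add.int_pow_1[of x]
      by (simp add: add_pow_def a_inv_def[symmetric] class_ring_simps)
  qed
  then show ?thesis
    using assms by (simp add: ring_det_def det_def class_ring_simps)
qed

lemma SL_complex_subring:
  assumes "subdomain R (class_ring :: complex ring)"
  shows "carrier (SL n (complex_subring R)) =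
      {A \<in> carrier_mat n n. elements_mat A \<subseteq> R \<and> det A = 1}"
    and "A \<in> carrier (SL n (complex_subring R)) \<Longrightarrow> B \<in> carrier (SL n (complex_subring R)) \<Longrightarrow>
      A \<otimes>\<^bsub>SL n (complex_subring R)\<^esub> B = A * B"
    and "\<one>\<^bsub>SL n (complex_subring R)\<^esub> = 1\<^sub>m n"
proof -
  let ?R = "complex_subring R"
  interpret I: ring_hom_cring ?R class_ring id
    by (rule complex_subring_id_hom[OF assms])
  have id: "map_mat id X = X" for X :: "complex mat"
    by (rule eq_matI) auto
  have "ring_det ?R A = det A" if "A \<in> carrier_mat n n" "elements_mat A \<subseteq> R" for A
    using hom_ring_det[OF I.ring_hom_cring_axioms, of A n] ring_det_class_ring[of A n] that
    by (simp add: id)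
  then show "carrier (SL n ?R) = {A \<in> carrier_mat n n. elements_mat A \<subseteq> R \<and> det A = 1}"
    by (auto simp: SL_def)
  show "\<one>\<^bsub>SL n ?R\<^esub> = 1\<^sub>m n"
    by (auto simp: SL_def one_mat_def)
  assume AB: "A \<in> carrier (SL n ?R)" "B \<in> carrier (SL n ?R)"
  then have "A \<otimes>\<^bsub>SL n ?R\<^esub> B = A \<otimes>\<^bsub>SL n class_ring\<^esub> B"
    using hom_mult[OF map_mat_hom_SL[OF I.ring_hom_cring_axioms, of n] AB] by (simp only: id)
  also have "\<dots> = A * B"
    using AB by (intro eq_matI) (auto simp: SL_def scalar_prod_def class_ring_simps)
  finally show "A \<otimes>\<^bsub>SL n ?R\<^esub> B = A * B" .
qed

end

theory Submission
  imports
    Defs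
    "HOL-Analysis.Continuum_Not_Denumerable"
    "HOL-Computational_Algebra.Fundamental_Theorem_Algebra"
begin

text \<open>
  A free group of any rank embeds into the principal congruence subgroup of level \<open>p\<close> of
  \<open>SL(2, \<int>)\<close>: conjugates of a parabolic matrix with a large entry divisible by \<open>p\<close> play ping-pong
  (\<open>word_mat_eq_one2D\<close>, \<open>word_mat_cong\<close>). An infinite, finitely generated, fully residually free group
  \<open>\<Gamma>\<close> has homomorphisms \<open>\<psi> n\<close> to free groups such that every \<open>g \<noteq> 1\<close> survives in all but finitely many
  of them (\<open>ex_separating_sequence\<close>). Composing and passing to the ultraproduct gives a single
  faithful representation \<open>\<tau>\<close> of \<open>\<Gamma>\<close> in \<open>SL(2)\<close> over the ultrapower of \<open>\<int>\<close>. That ring still maps onto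
  the field of order \<open>p\<close>, since a sequence of integers has a constant residue along the ultrafilter,
  and \<open>\<tau>\<close> reduces to the identity because each component does.

  The entries of \<open>\<tau>\<close> lie in a finitely generated subfield of the ultrapower of \<open>\<rat>\<close>. Such a field
  embeds into the complex numbers, one generator at a time (\<open>ex_subfield_embedding\<close>). The image
  of the integral elements of the subfield is the domain \<open>R\<close>, and \<open>\<tau>\<close> becomes a faithful
  representation \<open>\<sigma>\<close> in \<open>SL(2, R)\<close> with trivial reduction.

  The subgroup \<open>\<Delta>\<close> enters only at the end: \<open>\<sigma>\<close> is tensored with the regular representation of
  \<open>\<Gamma> / \<Delta>\<close>. The dimension becomes \<open>2 [\<Gamma> : \<Delta>]\<close>, the result is still faithful, its determinant is the square
  of a sign, and the reduction is a double copy of the regular representation of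
  \<open>\<Gamma> / \<Delta>\<close>, whose kernel is \<open>\<Delta>\<close> (\<open>ex_rep_with_reduction_kernel\<close>).
\<close>

section \<open>Two-by-two matrices and free congruence subgroups\<close>

type_synonym 'a mat2 = "'a \<times> 'a \<times> 'a \<times> 'a"

definition mult2 :: "'a::comm_ring_1 mat2 \<Rightarrow> 'a mat2 \<Rightarrow> 'a mat2" where
  "mult2 = (\<lambda>(a, b, c, d) (a', b', c', d').
    (a * a' + b * c', a * b' + b * d', c * a' + d * c', c * b' + d * d'))"

definition one2 :: "'a::comm_ring_1 mat2" where
  "one2 = (1, 0, 0, 1)"

definition det2 :: "'a::comm_ring_1 mat2 \<Rightarrow> 'a" where
  "det2 = (\<lambda>(a, b, c, d). a * d - b * c)"

lemma mult2_simp [simp]: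
  "mult2 (a, b, c, d) (a', b', c', d') =
    (a * a' + b * c', a * b' + b * d', c * a' + d * c', c * b' + d * d')"
  by (simp add: mult2_def)

lemma det2_simp [simp]: "det2 (a, b, c, d) = a * d - b * c"
  by (simp add: det2_def)

lemma mult2_one2 [simp]: "mult2 one2 A = A" "mult2 A one2 = A"
  by (cases A; simp add: one2_def)+

lemma mult2_assoc: "mult2 (mult2 A B) C = mult2 A (mult2 B C)"
  by (cases A; cases B; cases C) (simp add: algebra_simps)

lemma det2_mult2: "det2 (mult2 A B) = det2 A * det2 B"
  by (cases A; cases B) (simp add: algebra_simps)

lemma det2_one2 [simp]: "det2 one2 = 1"
  by (simp add: one2_def)

text \<open>
  The generator \<open>i\<close> is sent to the parabolic matrix
  \<open>[1 i; 0 1] [1 0; c 1] [1 -i; 0 1]\<close>: it fixes \<open>x - i y\<close> and adds \<open>c (x - i y)\<close> to \<open>y\<close>.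
  Conjugating by different translations makes the fixed points of the generators the distinct
  integers \<open>i\<close>, so that all ranks are treated at once.
\<close>

definition letter_mat :: "int \<Rightarrow> nat \<times> bool \<Rightarrow> int mat2" where
  "letter_mat c = (\<lambda>(i, s). let i = int i; e = (if s then c else - c)
    in (1 + i * e, - (i * i * e), e, 1 - i * e))"

definition word_mat :: "int \<Rightarrow> (nat \<times> bool) list \<Rightarrow> int mat2" where
  "word_mat c w = foldr (\<lambda>x. mult2 (letter_mat c x)) w one2"

lemma word_mat_simps [simp]:
  "word_mat c [] = one2"
  "word_mat c (x # w) = mult2 (letter_mat c x) (word_mat c w)"
  by (simp_all add: word_mat_def)

lemma det2_word_mat: "det2 (word_mat c w) = 1"
proof (induction w)
  case (Cons x w)
  have "det2 (letter_mat c x) = 1"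
    by (cases x) (simp add: letter_mat_def Let_def algebra_simps)
  with Cons show ?case by (simp add: det2_mult2)
qed simp

lemma letter_mat_inv_letter: "mult2 (letter_mat c x) (letter_mat c (inv_letter x)) = one2"
  by (cases x) (simp add: letter_mat_def inv_letter_def one2_def Let_def algebra_simps)

lemma word_mat_push: "word_mat c (push x w) = mult2 (letter_mat c x) (word_mat c w)"
  by (cases w) (auto simp: mult2_assoc[symmetric] letter_mat_inv_letter)

lemma word_mat_foldr_push:
  "word_mat c (foldr push u v) = mult2 (word_mat c u) (word_mat c v)"
  by (induction u) (simp_all add: word_mat_push mult2_assoc)

text \<open>
  A letter adds \<open>c * u\<close> to \<open>y\<close>, where \<open>u = x - i y\<close>. A coefficient of at least five
  outweighs any \<open>y\<close> with \<open>\<bar>y\<bar> \<le> 2 \<bar>u\<bar>\<close>, which covers the initial vector and a change of generator; when a letter is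
  repeated, \<open>y\<close> and \<open>c * u\<close> have the same sign, so that they cannot cancel.
\<close>

lemma ping_pong_step:
  fixes u y c :: int
  assumes "u \<noteq> 0" "c \<ge> 5" "\<bar>y\<bar> \<le> 2 * \<bar>u\<bar> \<or> u * y > 0"
  shows "2 * \<bar>u\<bar> < \<bar>y + c * u\<bar> \<and> u * (y + c * u) > 0"
proof (cases "u > 0")
  case True
  then have "y \<ge> - 2 * u" using assms(3) by (auto simp: zero_less_mult_iff)
  moreover have "c * u \<ge> 5 * u" using True assms(2) by (intro mult_right_mono) auto
  ultimately have "y + c * u > 2 * u" using True by linarith
  then show ?thesis using True by (auto simp: zero_less_mult_iff)
next
  case False
  with assms have u: "u < 0" by simp
  then have "y \<le> - 2 * u" using assms(3) by (auto simp: zero_less_mult_iff)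
  moreover have "c * u \<le> 5 * u" using u assms(2) by (intro mult_right_mono_neg) auto
  ultimately have "y + c * u < 2 * u" using u by linarith
  then show ?thesis using u by (auto simp: zero_less_mult_iff)
qed

text \<open>
  Ping-pong on the orbit of the vector \<open>(1, 0)\<close>, whose image is the first column \<open>(x, y)\<close>: after a
  reduced word starting with a letter of index \<open>i\<close>, the ratio \<open>x / y\<close> lies within distance one
  half of the integer \<open>i\<close>, on the side determined by the sign of the letter. In particular
  \<open>y\<close> is nonzero, so that a nonempty reduced word does not act as the identity.
\<close>

lemma word_mat_ping_pong:
  assumes "c \<ge> 5" "reduced ((i, s) # w)"
    and "word_mat c ((i, s) # w) = (x, b, y, d)"
  shows "2 * \<bar>x - int i * y\<bar> < \<bar>y\<bar> \<and>
    (if s then (x - int i * y) * y > 0 else (x - int i * y) * y < 0)"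
  using assms(2,3)
proof (induction w arbitrary: i s x b y d)
  have step: "2 * \<bar>x - int i * y\<bar> < \<bar>y\<bar> \<and>
      (if s then (x - int i * y) * y > 0 else (x - int i * y) * y < 0)"
    if "word_mat c ((i, s) # w) = (x, b, y, d)" "word_mat c w = (x', b', y', d')"
      and u: "x' - int i * y' \<noteq> 0"
        "\<bar>y'\<bar> \<le> 2 * \<bar>x' - int i * y'\<bar> \<or> (if s then (x' - int i * y') * y' > 0 else (x' - int i * y') * y' < 0)"
    for i s w x b y d x' b' y' d'
  proof -
    define u where "u = x' - int i * y'"
    have y: "y = y' + (if s then c else - c) * u"
      using that(1,2) by (auto simp: letter_mat_def Let_def u_def algebra_simps)
    have "x = x' + int i * ((if s then c else - c) * u)"
      using that(1,2) by (auto simp: letter_mat_def Let_def u_def algebra_simps)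
    then have x: "x - int i * y = u"
      by (simp add: y u_def algebra_simps)
    show ?thesis
    proof (cases s)
      case True
      have "2 * \<bar>u\<bar> < \<bar>y\<bar> \<and> u * y > 0"
        unfolding y using ping_pong_step[of u c y'] u assms(1) True by (auto simp: u_def)
      then show ?thesis using True x by simp
    next
      case False
      \<comment> \<open>For an inverse letter the step is applied to \<open>- y\<close>.\<close>
      have "2 * \<bar>u\<bar> < \<bar>- y' + c * u\<bar> \<and> u * (- y' + c * u) > 0"
        by (rule ping_pong_step) (use u False assms(1) in \<open>auto simp: u_def\<close>)
      moreover have "- y' + c * u = - y" using y False by simp
      ultimately have "2 * \<bar>u\<bar> < \<bar>y\<bar> \<and> u * y < 0" by simp
      then show ?thesis using False x by simp
    qed
  qed
  {
    case Nil
    show ?case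
      by (rule step[OF Nil(2), of 1 0 0 1]) (auto simp: one2_def)
  next
    case (Cons l w)
    obtain j t where l: "l = (j, t)" by force
    obtain x' b' y' d' where M: "word_mat c (l # w) = (x', b', y', d')"
      by (metis prod_cases4)
    have red: "reduced ((j, t) # w)" using Cons.prems(1) l by (auto dest: reduced_ConsD)
    note IH = Cons.IH[OF red M[unfolded l]]
    have far: "\<bar>y'\<bar> < 2 * \<bar>x' - int i * y'\<bar>" if "j \<noteq> i"
    proof -
      have "1 * \<bar>y'\<bar> \<le> \<bar>int i - int j\<bar> * \<bar>y'\<bar>"
        by (rule mult_right_mono) (use that in auto)
      also have "\<dots> = \<bar>(x' - int j * y') - (x' - int i * y')\<bar>"
        by (simp add: abs_mult[symmetric] left_diff_distrib)
      finally have "\<bar>y'\<bar> \<le> \<bar>x' - int j * y'\<bar> + \<bar>x' - int i * y'\<bar>"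
        by (simp add: order_trans[OF _ abs_triangle_ineq4])
      moreover have "Y < 2 * B" if "2 * A < Y" "Y \<le> A + B" for A B Y :: int
        using that by linarith
      ultimately show ?thesis using conjunct1[OF IH] by blast
    qed
    show ?case
    proof (rule step[OF Cons.prems(2) M])
      show "x' - int i * y' \<noteq> 0"
        using IH far by (cases "j = i") (auto split: if_splits)
      have "t = s" if "j = i"
        using Cons.prems(1) l that by (auto simp: reduced_def inv_letter_def)
      then show "\<bar>y'\<bar> \<le> 2 * \<bar>x' - int i * y'\<bar> \<or>
        (if s then (x' - int i * y') * y' > 0 else (x' - int i * y') * y' < 0)"
        using IH far by (cases "j = i") auto
    qed
  }
qed

lemma word_mat_eq_one2D:
  assumes "c \<ge> 5" "reduced w" "word_mat c w = one2"
  shows "w = []"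
proof (cases w)
  case (Cons l v)
  obtain i s where "l = (i, s)" by force
  then show ?thesis
    using word_mat_ping_pong[of c i s v 1 0 0 1] assms Cons by (simp add: one2_def)
qed

lemma word_mat_cong:
  assumes "m dvd c" "word_mat c w = (x, y, z, t)"
  shows "m dvd x - 1" "m dvd y" "m dvd z" "m dvd t - 1"
proof -
  have "m dvd x - 1 \<and> m dvd y \<and> m dvd z \<and> m dvd t - 1"
    using assms(2)
  proof (induction w arbitrary: x y z t)
    case Nil
    then show ?case by (auto simp: one2_def)
  next
    case (Cons l w)
    obtain i s where l: "l = (i, s)" by force
    obtain x' y' z' t' where M: "word_mat c w = (x', y', z', t')"
      by (metis prod_cases4)
    obtain k where k: "(if s then c else - c) = m * k"
      using assms(1) by (auto elim!: dvdE) (metis mult_minus_right)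
    have e: "x - 1 = (x' - 1) + m * (k * int i * x' - int i * int i * k * z')"
      "y = y' + m * (k * int i * y' - int i * int i * k * t')"
      "z = z' + m * (k * x' - k * int i * z')"
      "t - 1 = (t' - 1) + m * (k * y' - k * int i * t')"
      using Cons.prems M by (auto simp: letter_mat_def Let_def l k algebra_simps)
    show ?case
      unfolding e using Cons.IH[OF M] by (metis dvd_add dvd_triv_left)
  qed
  then show "m dvd x - 1" "m dvd y" "m dvd z" "m dvd t - 1" by auto
qed

section \<open>Separating families of homomorphisms to free groups\<close>

text \<open>
  Injectivity on \<open>{h} \<union> h T\<close> makes all elements of \<open>T\<close> survive; since the group is infinite, \<open>h\<close> can be
  chosen such that this set avoids the identity.
\<close>

lemma fully_residually_free_survive:
  fixes G (structure)
  assumes "group G" "infinite (carrier G)" "fully_residually_free G"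
    and T: "finite T" "T \<subseteq> carrier G - {\<one>\<^bsub>G\<^esub>}"
  shows "\<exists>r. \<exists>\<psi>\<in>hom G (free_group r). \<forall>t\<in>T. \<psi> t \<noteq> []"
proof -
  interpret group G by fact
  have "infinite (carrier G - insert \<one> (m_inv G ` T))"
    using assms(2) T by (intro Diff_infinite_finite) auto
  then obtain h where h: "h \<in> carrier G" "h \<noteq> \<one>" "h \<notin> m_inv G ` T"
    using infinite_imp_nonempty[of "carrier G - insert \<one> (m_inv G ` T)"] by blast
  have "h \<otimes> t \<noteq> \<one>" if "t \<in> T" for t
    using h that T inv_equality[of h t] by auto
  then have "finite (insert h ((\<lambda>t. h \<otimes> t) ` T))" "insert h ((\<lambda>t. h \<otimes> t) ` T) \<subseteq> carrier G - {\<one>}"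
    using h T by auto
  then have "\<exists>r. \<exists>\<psi>\<in>hom G (free_group r). inj_on \<psi> (insert h ((\<lambda>t. h \<otimes> t) ` T))"
    by (intro assms(3)[unfolded fully_residually_free_def, rule_format] conjI)
  then obtain r \<psi> where \<psi>: "\<psi> \<in> hom G (free_group r)" "inj_on \<psi> (insert h ((\<lambda>t. h \<otimes> t) ` T))"
    by blast
  have "\<psi> t \<noteq> []" if t: "t \<in> T" for t
  proof
    assume "\<psi> t = []"
    moreover have "\<psi> h \<in> carrier (free_group r)" using \<psi>(1) h by (auto simp: hom_def)
    then have "foldr push (\<psi> h) [] = \<psi> h"
      by (intro foldr_push_Nil) (simp add: free_group_def)
    moreover have "\<psi> (h \<otimes> t) = foldr push (\<psi> h) (\<psi> t)"
      using \<psi>(1) h t T by (auto simp: hom_def free_group_def)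
    ultimately have "\<psi> (h \<otimes> t) = \<psi> h" by simp
    then have "h \<otimes> t = h" by (rule inj_onD[OF \<psi>(2)]) (use t in auto)
    then show False using h t T by auto
  qed
  then show ?thesis using \<psi>(1) by blast
qed

text \<open>The generated subgroup consists of the products of lists over the generators and their inverses.\<close>

lemma countable_generate:
  fixes G (structure)
  assumes "group G" "countable S" "S \<subseteq> carrier G"
  shows "countable (generate G S)"
proof -
  interpret group G by fact
  let ?L = "lists (S \<union> m_inv G ` S)"
  let ?prod = "\<lambda>ws. foldr (\<otimes>) ws \<one>"
  have L: "set ws \<subseteq> carrier G" if "ws \<in> ?L" for ws
    using that assms(3) by (auto simp: in_lists_conv_set)
  have closed: "?prod ws \<in> carrier G" if "set ws \<subseteq> carrier G" for ws
    using that by (induction ws) auto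
  have append: "?prod (vs @ ws) = ?prod vs \<otimes> ?prod ws"
    if "set vs \<subseteq> carrier G" "set ws \<subseteq> carrier G" for vs ws
    using that by (induction vs) (auto simp: closed m_assoc simp del: foldr_append)
  have "g \<in> ?prod ` ?L" if "g \<in> generate G S" for g
    using that
  proof induction
    case one
    show ?case by (rule image_eqI[of _ _ "[]"]) auto
  next
    case (incl h)
    then show ?case using assms(3) by (intro image_eqI[of _ _ "[h]"]) auto
  next
    case (inv h)
    then show ?case using assms(3) by (intro image_eqI[of _ _ "[inv h]"]) auto
  next
    case (eng g h)
    then obtain vs ws where "vs \<in> ?L" "g = ?prod vs" "ws \<in> ?L" "h = ?prod ws" by blast
    then show ?case
      using append[OF L L, of vs ws] by (intro image_eqI[of _ _ "vs @ ws"]) auto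
  qed
  then have "generate G S \<subseteq> ?prod ` ?L" by blast
  moreover have "countable (?prod ` ?L)" using assms(2) by auto
  ultimately show ?thesis by (rule countable_subset)
qed

text \<open>
  The group is countable, so \<open>\<psi> n\<close> can be chosen to keep the nontrivial ones among the first \<open>n\<close>
  elements alive. The ranks of the target free groups may vary with \<open>n\<close>.
\<close>

lemma ex_separating_sequence:
  fixes G :: "('a, 'b) monoid_scheme"
  assumes "group G" "infinite (carrier G)" "finitely_generated G" "fully_residually_free G"
  shows "\<exists>\<psi> :: nat \<Rightarrow> 'a \<Rightarrow> (nat \<times> bool) list. (\<forall>n. \<exists>r. \<psi> n \<in> hom G (free_group r)) \<and>
    (\<forall>g \<in> carrier G - {\<one>\<^bsub>G\<^esub>}. eventually (\<lambda>n. \<psi> n g \<noteq> []) sequentially)"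
proof -
  have countable: "countable (carrier G)"
    using assms(3) countable_generate[OF assms(1)] uncountable_infinite
    unfolding finitely_generated_def by metis
  define T where "T = (\<lambda>n. from_nat_into (carrier G) ` {..<n} - {\<one>\<^bsub>G\<^esub>})"
  have "carrier G \<noteq> {}" using assms(2) by auto
  then have T: "finite (T n)" "T n \<subseteq> carrier G - {\<one>\<^bsub>G\<^esub>}" for n
    using from_nat_into[of "carrier G"] by (auto simp: T_def)
  have "\<exists>\<psi> :: 'a \<Rightarrow> (nat \<times> bool) list. (\<exists>r. \<psi> \<in> hom G (free_group r)) \<and> (\<forall>t\<in>T n. \<psi> t \<noteq> [])" for n
    using fully_residually_free_survive[OF assms(1,2,4) T[of n]] by blast
  then obtain \<psi> :: "nat \<Rightarrow> 'a \<Rightarrow> (nat \<times> bool) list"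
    where \<psi>: "\<And>n. \<exists>r. \<psi> n \<in> hom G (free_group r)" "\<And>n t. t \<in> T n \<Longrightarrow> \<psi> n t \<noteq> []"
    by metis
  have "eventually (\<lambda>n. \<psi> n g \<noteq> []) sequentially" if g: "g \<in> carrier G - {\<one>\<^bsub>G\<^esub>}" for g
  proof -
    have "g = from_nat_into (carrier G) (to_nat_on (carrier G) g)"
      using countable g by simp
    then have "g \<in> T n" if "n > to_nat_on (carrier G) g" for n
      using g that unfolding T_def by blast
    then show ?thesis
      using \<psi>(2) by (auto simp: eventually_sequentially intro!: exI[of _ "Suc (to_nat_on (carrier G) g)"])
  qed
  with \<psi>(1) show ?thesis by blast
qed

section \<open>The ultrapower of the rational numbers\<close>

text \<open>
  By Zorn's lemma there is a minimal proper filter below \<open>F\<close>; if it did not decide some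
  predicate, restricting it to that predicate would give a smaller one.
\<close>

lemma ex_ultrafilter_le:
  fixes F :: "'a filter"
  assumes "F \<noteq> bot"
  shows "\<exists>U \<le> F. U \<noteq> bot \<and> (\<forall>P. eventually P U \<or> eventually (\<lambda>x. \<not> P x) U)"
proof -
  define A where "A = {G. G \<le> F \<and> G \<noteq> bot}"
  have "\<exists>U\<in>A. \<forall>G\<in>A. G \<le> U \<longrightarrow> G = U"
  proof (rule predicate_Zorn)
    show "partial_order_on A (relation_of (\<lambda>G H. H \<le> G) A)"
      by (rule partial_order_on_relation_ofI) auto
    fix C assume C: "C \<in> Chains (relation_of (\<lambda>G H. H \<le> G) A)"
    then have CA: "C \<subseteq> A" and lin: "\<And>G H. G \<in> C \<Longrightarrow> H \<in> C \<Longrightarrow> G \<le> H \<or> H \<le> G"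
      by (auto simp: Chains_def relation_of_def)
    show "\<exists>u\<in>A. \<forall>a\<in>C. u \<le> a"
    proof (cases "C = {}")
      case True
      then show ?thesis using assms by (auto simp: A_def)
    next
      case False
      have ev: "eventually P (Inf C) \<longleftrightarrow> (\<exists>G\<in>C. eventually P G)" for P
        by (rule eventually_Inf_base[OF False]) (use lin in \<open>fastforce simp: inf.absorb1 inf.absorb2\<close>)
      have "Inf C \<noteq> bot"
        using CA by (auto simp: trivial_limit_def ev A_def)
      moreover have "Inf C \<le> F"
        using False CA by (auto simp: A_def intro: Inf_lower2)
      ultimately show ?thesis
        by (intro bexI[of _ "Inf C"]) (auto simp: A_def intro: Inf_lower)
    qed
  qed
  then obtain U where U: "U \<in> A" and min: "\<And>G. G \<in> A \<Longrightarrow> G \<le> U \<Longrightarrow> G = U" by blast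
  have "eventually P U \<or> eventually (\<lambda>x. \<not> P x) U" for P
  proof (rule disjCI)
    assume "\<not> eventually (\<lambda>x. \<not> P x) U"
    then have "inf U (principal {x. P x}) \<noteq> bot"
      by (simp add: trivial_limit_def eventually_inf_principal)
    moreover have "inf U (principal {x. P x}) \<le> F"
      using U by (auto simp: A_def intro: le_infI1)
    ultimately have "inf U (principal {x. P x}) = U"
      by (intro min) (auto simp: A_def)
    moreover have "eventually P (inf U (principal {x. P x}))"
      by (simp add: eventually_inf_principal)
    ultimately show "eventually P U" by simp
  qed
  then show ?thesis using U by (auto simp: A_def)
qed

definition ultra :: "nat filter" where
  "ultra = (SOME U. U \<le> sequentially \<and> U \<noteq> bot \<and>
    (\<forall>P. eventually P U \<or> eventually (\<lambda>x. \<not> P x) U))"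

lemma
  shows ultra_le_sequentially: "ultra \<le> sequentially"
    and ultra_neq_bot [simp]: "ultra \<noteq> bot"
    and eventually_ultra_cases: "eventually P ultra \<or> eventually (\<lambda>x. \<not> P x) ultra"
proof -
  have "ultra \<le> sequentially \<and> ultra \<noteq> bot \<and>
      (\<forall>P. eventually P ultra \<or> eventually (\<lambda>x. \<not> P x) ultra)"
    unfolding ultra_def
    by (rule someI_ex, use ex_ultrafilter_le[of "sequentially"] in auto)
  then show "ultra \<le> sequentially" "ultra \<noteq> bot"
    "eventually P ultra \<or> eventually (\<lambda>x. \<not> P x) ultra" by auto
qed

lemma not_eventually_ultra: "\<not> eventually P ultra \<Longrightarrow> eventually (\<lambda>x. \<not> P x) ultra"
  using eventually_ultra_cases by blast

quotient_type hyperrat = "nat \<Rightarrow> rat" / "\<lambda>f g. eventually (\<lambda>n. f n = g n) ultra"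
  by (auto intro!: equivpI reflpI sympI transpI elim: eventually_mono eventually_elim2)

instantiation hyperrat :: field
begin

lift_definition zero_hyperrat :: hyperrat is "\<lambda>_. 0" .
lift_definition one_hyperrat :: hyperrat is "\<lambda>_. 1" .
lift_definition plus_hyperrat :: "hyperrat \<Rightarrow> hyperrat \<Rightarrow> hyperrat" is "\<lambda>f g n. f n + g n"
  by (auto elim: eventually_elim2)
lift_definition minus_hyperrat :: "hyperrat \<Rightarrow> hyperrat \<Rightarrow> hyperrat" is "\<lambda>f g n. f n - g n"
  by (auto elim: eventually_elim2)
lift_definition times_hyperrat :: "hyperrat \<Rightarrow> hyperrat \<Rightarrow> hyperrat" is "\<lambda>f g n. f n * g n"
  by (auto elim: eventually_elim2)
lift_definition divide_hyperrat :: "hyperrat \<Rightarrow> hyperrat \<Rightarrow> hyperrat" is "\<lambda>f g n. f n / g n"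
  by (auto elim: eventually_elim2)
lift_definition uminus_hyperrat :: "hyperrat \<Rightarrow> hyperrat" is "\<lambda>f n. - f n"
  by (auto elim: eventually_mono)
lift_definition inverse_hyperrat :: "hyperrat \<Rightarrow> hyperrat" is "\<lambda>f n. inverse (f n)"
  by (auto elim: eventually_mono)

instance
proof
  fix a b c :: hyperrat
  show "a * b * c = a * (b * c)" by transfer (simp add: mult.assoc)
  show "a * b = b * a" by transfer (simp add: mult.commute)
  show "1 * a = a" by transfer simp
  show "a + b + c = a + (b + c)" by transfer (simp add: add.assoc)
  show "a + b = b + a" by transfer (simp add: add.commute)
  show "0 + a = a" by transfer simp
  show "- a + a = 0" by transfer simp
  show "a - b = a + - b" by transfer simp
  show "(a + b) * c = a * c + b * c" by transfer (simp add: distrib_right)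
  show "a div b = a * inverse b" by transfer (simp add: divide_inverse)
  show "inverse 0 = (0 :: hyperrat)" by transfer simp
  show "0 \<noteq> (1 :: hyperrat)"
    by transfer (simp add: trivial_limit_def[symmetric])
  show "a \<noteq> 0 \<Longrightarrow> inverse a * a = 1"
    by transfer (auto dest!: not_eventually_ultra elim: eventually_mono)
qed

end

text \<open>The range of this map is the ultrapower of the integers, the subring on which reduction modulo \<open>p\<close> lives.\<close>

definition hyper :: "(nat \<Rightarrow> int) \<Rightarrow> hyperrat" where
  "hyper a = abs_hyperrat (\<lambda>n. of_int (a n))"

lemma hyper_eq_iff: "hyper a = hyper b \<longleftrightarrow> eventually (\<lambda>n. a n = b n) ultra"
  by (simp add: hyper_def hyperrat.abs_eq_iff)

lemma hyper_simps:
  "hyper a + hyper b = hyper (\<lambda>n. a n + b n)"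
  "hyper a - hyper b = hyper (\<lambda>n. a n - b n)"
  "hyper a * hyper b = hyper (\<lambda>n. a n * b n)"
  "- hyper a = hyper (\<lambda>n. - a n)"
  "0 = hyper (\<lambda>_. 0)" "1 = hyper (\<lambda>_. 1)"
  by (simp_all add: hyper_def plus_hyperrat.abs_eq minus_hyperrat.abs_eq times_hyperrat.abs_eq
      uminus_hyperrat.abs_eq zero_hyperrat_def one_hyperrat_def)

lemma of_nat_hyperrat: "of_nat k = hyper (\<lambda>_. int k)"
  by (induction k) (simp_all add: hyper_simps)

instance hyperrat :: field_char_0
  by standard (auto simp: inj_on_def of_nat_hyperrat hyper_eq_iff)

lemma of_int_hyperrat: "of_int k = hyper (\<lambda>_. k)"
  by (cases k rule: int_cases2) (simp_all add: of_nat_hyperrat hyper_simps)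

text \<open>
  A sequence of integers has a constant residue modulo \<open>p\<close> along the ultrafilter, since the
  finitely many residue classes partition the index set.
\<close>

lemma ex_residue_ultra:
  fixes a :: "nat \<Rightarrow> int"
  assumes "p > 0"
  shows "\<exists>k. eventually (\<lambda>n. a n mod p = k) ultra"
proof (rule ccontr)
  assume "\<nexists>k. eventually (\<lambda>n. a n mod p = k) ultra"
  then have "eventually (\<lambda>n. \<forall>k\<in>{0..<p}. a n mod p \<noteq> k) ultra"
    by (intro eventually_ball_finite) (auto intro: not_eventually_ultra)
  then have "eventually (\<lambda>_. False) ultra"
    by (rule eventually_mono) (use assms in auto)
  then show False by (simp add: trivial_limit_def[symmetric])
qed

text \<open>
  The existential quantifier makes the residue independent of the representing sequence; the value
  is meaningful on classes of integer sequences only.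
\<close>

definition hyper_mod :: "int \<Rightarrow> hyperrat \<Rightarrow> int" where
  "hyper_mod p x = (THE k. \<exists>a. x = hyper a \<and> eventually (\<lambda>n. a n mod p = k) ultra)"

lemma hyper_mod_eqI:
  assumes "eventually (\<lambda>n. a n mod p = k) ultra"
  shows "hyper_mod p (hyper a) = k"
  unfolding hyper_mod_def
proof (rule the_equality)
  fix k' assume "\<exists>b. hyper a = hyper b \<and> eventually (\<lambda>n. b n mod p = k') ultra"
  then obtain b where "eventually (\<lambda>n. a n = b n) ultra" "eventually (\<lambda>n. b n mod p = k') ultra"
    by (auto simp: hyper_eq_iff)
  with assms have "eventually (\<lambda>n. k' = k) ultra"
    by eventually_elim auto
  then show "k' = k" by simp
qed (use assms in auto)

lemma hyper_mod_const: "hyper_mod p (hyper (\<lambda>_. k)) = k mod p"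
  by (rule hyper_mod_eqI) simp

lemma hyper_mod_hom:
  assumes "p > 0"
  shows "hyper_mod p (hyper a) \<in> {0..p - 1}"
    and "hyper_mod p (hyper a + hyper b) = (hyper_mod p (hyper a) + hyper_mod p (hyper b)) mod p"
    and "hyper_mod p (hyper a * hyper b) = (hyper_mod p (hyper a) * hyper_mod p (hyper b)) mod p"
proof -
  obtain k where k: "eventually (\<lambda>n. a n mod p = k) ultra" using ex_residue_ultra[OF assms] by blast
  obtain l where l: "eventually (\<lambda>n. b n mod p = l) ultra" using ex_residue_ultra[OF assms] by blast
  note kl = hyper_mod_eqI[OF k] hyper_mod_eqI[OF l]
  have "eventually (\<lambda>n. k \<in> {0..p - 1}) ultra"
    using k by (rule eventually_mono) (use assms in auto)
  then show "hyper_mod p (hyper a) \<in> {0..p - 1}" by (simp add: kl)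
  show "hyper_mod p (hyper a + hyper b) = (hyper_mod p (hyper a) + hyper_mod p (hyper b)) mod p"
    unfolding hyper_simps kl
    by (rule hyper_mod_eqI) (use k l in \<open>eventually_elim, auto simp: mod_simps\<close>)
  show "hyper_mod p (hyper a * hyper b) = (hyper_mod p (hyper a) * hyper_mod p (hyper b)) mod p"
    unfolding hyper_simps kl
    by (rule hyper_mod_eqI) (use k l in \<open>eventually_elim, auto simp: mod_simps\<close>)
qed

section \<open>Embedding finitely generated fields into the complex numbers\<close>

text \<open>
  The field \<open>K\<close> is a subset of the ambient field \<open>'a\<close>, because the extension argument lets it vary, and
  \<open>h\<close> is constrained on \<open>K\<close> only. Such a map is automatically injective on \<open>K\<close>.
\<close>

locale subfield_embedding =
  fixes K :: "'a::Fields.field set" and h :: "'a \<Rightarrow> complex"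
  assumes one_mem: "1 \<in> K"
    and diff_mem: "x \<in> K \<Longrightarrow> y \<in> K \<Longrightarrow> x - y \<in> K"
    and mult_mem: "x \<in> K \<Longrightarrow> y \<in> K \<Longrightarrow> x * y \<in> K"
    and inverse_mem: "x \<in> K \<Longrightarrow> inverse x \<in> K"
    and h_one: "h 1 = 1"
    and h_add: "x \<in> K \<Longrightarrow> y \<in> K \<Longrightarrow> h (x + y) = h x + h y"
    and h_mult: "x \<in> K \<Longrightarrow> y \<in> K \<Longrightarrow> h (x * y) = h x * h y"
begin

lemma zero_mem: "0 \<in> K"
  using diff_mem[OF one_mem one_mem] by simp

lemma uminus_mem: "x \<in> K \<Longrightarrow> - x \<in> K"
  using diff_mem[OF zero_mem] by simp

lemma add_mem: "x \<in> K \<Longrightarrow> y \<in> K \<Longrightarrow> x + y \<in> K"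
  using diff_mem[of x "- y"] uminus_mem[of y] by simp

lemma h_zero: "h 0 = 0"
  using h_add[OF zero_mem zero_mem] by simp

lemma h_diff: "x \<in> K \<Longrightarrow> y \<in> K \<Longrightarrow> h (x - y) = h x - h y"
  using h_add[OF diff_mem[of x y], of y] by simp

lemma h_eq_zero: "x \<in> K \<Longrightarrow> h x = 0 \<longleftrightarrow> x = 0"
  using h_mult[OF _ inverse_mem, of x x] h_one h_zero by (cases "x = 0") auto

lemma inj_on_h: "inj_on h K"
  by (rule inj_onI) (metis h_diff h_eq_zero diff_mem right_minus_eq)

lemma sum_mem: "(\<And>i. i \<in> S \<Longrightarrow> g i \<in> K) \<Longrightarrow> sum g S \<in> K"
  by (induction S rule: infinite_finite_induct) (auto simp: zero_mem add_mem)

lemma h_sum: "(\<And>i. i \<in> S \<Longrightarrow> g i \<in> K) \<Longrightarrow> h (sum g S) = (\<Sum>i\<in>S. h (g i))"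
  by (induction S rule: infinite_finite_induct) (auto simp: h_zero h_add sum_mem)

definition polys :: "'a poly set" where
  "polys = {f. \<forall>i. coeff f i \<in> K}"

abbreviation H :: "'a poly \<Rightarrow> complex poly" where
  "H \<equiv> map_poly h"

lemma coeff_H: "coeff (H f) i = h (coeff f i)"
  by (simp add: coeff_map_poly h_zero)

lemma polys_diff: "f \<in> polys \<Longrightarrow> g \<in> polys \<Longrightarrow> f - g \<in> polys"
  by (simp add: polys_def diff_mem)

lemma polys_add: "f \<in> polys \<Longrightarrow> g \<in> polys \<Longrightarrow> f + g \<in> polys"
  by (simp add: polys_def add_mem)

lemma polys_mult: "f \<in> polys \<Longrightarrow> g \<in> polys \<Longrightarrow> f * g \<in> polys"
  by (simp add: polys_def coeff_mult mult_mem sum_mem)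

lemma polys_monom: "c \<in> K \<Longrightarrow> monom c n \<in> polys"
  by (simp add: polys_def zero_mem)

lemma polys_0: "0 \<in> polys"
  using zero_mem by (simp add: polys_def)

lemma H_add: "f \<in> polys \<Longrightarrow> g \<in> polys \<Longrightarrow> H (f + g) = H f + H g"
  by (rule poly_eqI) (simp add: coeff_H polys_def h_add)

lemma H_diff: "f \<in> polys \<Longrightarrow> g \<in> polys \<Longrightarrow> H (f - g) = H f - H g"
  by (rule poly_eqI) (simp add: coeff_H polys_def h_diff)

lemma H_mult: "f \<in> polys \<Longrightarrow> g \<in> polys \<Longrightarrow> H (f * g) = H f * H g"
  by (rule poly_eqI) (simp add: coeff_H polys_def coeff_mult h_sum h_mult mult_mem)

lemma H_eq_0_iff: "f \<in> polys \<Longrightarrow> H f = 0 \<longleftrightarrow> f = 0"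
  by (simp add: poly_eq_iff coeff_H polys_def h_eq_zero)

lemma degree_H: "f \<in> polys \<Longrightarrow> degree (H f) = degree f"
  by (cases "f = 0") (auto intro!: map_poly_degree_eq simp: h_eq_zero polys_def)

lemma countable_polys: "countable K \<Longrightarrow> countable polys"
proof -
  assume "countable K"
  moreover have "f \<in> Poly ` lists K" if "f \<in> polys" for f
  proof -
    have "coeffs f \<in> lists K"
      using that by (auto simp: polys_def coeffs_def in_lists_conv_set)
    then show ?thesis by (metis Poly_coeffs image_eqI)
  qed
  then have "polys \<subseteq> Poly ` lists K" by blast
  ultimately show ?thesis by (meson countable_image countable_lists countable_subset)
qed

text \<open>
  Division with remainder only ever divides by the leading coefficient of \<open>q\<close>, so it does not leave
  the polynomials over the subfield \<open>K\<close>.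
\<close>

lemma polys_divide:
  assumes "q \<in> polys" "q \<noteq> 0" "f \<in> polys"
  shows "\<exists>g\<in>polys. \<exists>r\<in>polys. f = q * g + r \<and> (r = 0 \<or> degree r < degree q)"
  using assms(3)
proof (induction "if f = 0 then 0 else Suc (degree f)" arbitrary: f rule: less_induct)
  case less
  show ?case
  proof (cases "f = 0 \<or> degree f < degree q")
    case True
    then show ?thesis using less.prems by (intro bexI[of _ 0] bexI[of _ f]) (auto simp: polys_0)
  next
    case False
    define t where "t = monom (lead_coeff f * inverse (lead_coeff q)) (degree f - degree q)"
    have t: "t \<in> polys"
      unfolding t_def using assms(1) less.prems
      by (intro polys_monom mult_mem inverse_mem) (auto simp: polys_def)
    have "coeff (t * q) (degree f) = lead_coeff f"
      using False assms(2) by (simp add: t_def coeff_monom_mult)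
    moreover have "degree (t * q) \<le> degree f"
    proof -
      have "degree t \<le> degree f - degree q" unfolding t_def by (rule degree_monom_le)
      then show ?thesis using degree_mult_le[of t q] False by linarith
    qed
    ultimately have "f - t * q = 0 \<or> degree (f - t * q) < degree f"
      by (intro eq_zero_or_degree_less degree_diff_le) auto
    then have "(if f - t * q = 0 then 0 else Suc (degree (f - t * q))) < (if f = 0 then 0 else Suc (degree f))"
      using False by auto
    moreover have "f - t * q \<in> polys"
      using less.prems assms(1) t by (intro polys_diff polys_mult)
    ultimately obtain g r where gr: "g \<in> polys" "r \<in> polys" "f - t * q = q * g + r"
        "r = 0 \<or> degree r < degree q"
      using less.hyps[of "f - t * q"] by blast
    show ?thesis
      by (rule bexI[of _ "g + t"], rule bexI[of _ r])
         (use gr t polys_add in \<open>auto simp: algebra_simps\<close>)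
  qed
qed

text \<open>
  The remainder of \<open>f\<close> on division by \<open>q\<close> lies in \<open>I\<close> again, and the minimality of \<open>q\<close> makes it vanish. This
  serves for the polynomials vanishing at an element of the large field and for those whose
  images vanish at a complex number.
\<close>

lemma min_degree_generates:
  assumes I: "I \<subseteq> polys" "\<And>f q g. f \<in> I \<Longrightarrow> q \<in> I \<Longrightarrow> g \<in> polys \<Longrightarrow> f - q * g \<in> I"
    and "q \<in> I" "q \<noteq> 0" and min: "\<And>f. f \<in> I \<Longrightarrow> f \<noteq> 0 \<Longrightarrow> degree q \<le> degree f"
    and "f \<in> I"
  shows "\<exists>g\<in>polys. f = q * g"
proof -
  obtain g r where gr: "g \<in> polys" "f = q * g + r" "r = 0 \<or> degree r < degree q"
    using polys_divide[of q f] subsetD[OF I(1)] \<open>q \<in> I\<close> \<open>q \<noteq> 0\<close> \<open>f \<in> I\<close> by blast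
  then have "r \<in> I" using I(2)[OF \<open>f \<in> I\<close> \<open>q \<in> I\<close>, of g] by simp
  then have "r = 0" using gr(3) min[of r] by linarith
  then show ?thesis using gr by auto
qed

text \<open>
  Every element \<open>a\<close> of the large field has a counterpart \<open>z\<close> among the complex numbers that satisfies
  the same polynomial equations over \<open>K\<close>: a root of the image of the minimal polynomial of \<open>a\<close>
  if \<open>a\<close> is algebraic, and otherwise a number avoiding the countably many roots of the
  polynomials over the image of \<open>K\<close>.
\<close>

lemma ex_complex_counterpart:
  assumes "countable K"
  shows "\<exists>z. \<forall>f\<in>polys. poly f a = 0 \<longleftrightarrow> poly (H f) z = 0"
proof (cases "\<exists>f\<in>polys. f \<noteq> 0 \<and> poly f a = 0")
  case True
  define I where "I = {f \<in> polys. poly f a = 0}"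
  have I: "I \<subseteq> polys" "\<And>f q g. f \<in> I \<Longrightarrow> q \<in> I \<Longrightarrow> g \<in> polys \<Longrightarrow> f - q * g \<in> I"
    by (auto simp: I_def polys_diff polys_mult)
  from True obtain q0 where "q0 \<in> I \<and> q0 \<noteq> 0" by (auto simp: I_def)
  from ex_has_least_nat[of "\<lambda>f. f \<in> I \<and> f \<noteq> 0", OF this, of degree]
  obtain q where q: "q \<in> I" "q \<noteq> 0" and q_min: "\<And>f. f \<in> I \<Longrightarrow> f \<noteq> 0 \<Longrightarrow> degree q \<le> degree f"
    by blast
  have "degree q \<noteq> 0"
    using q degree_eq_zeroE[of q] by (force simp: I_def)
  then have "\<not> constant (poly (H q))"
    using q degree_H[of q] by (simp add: I_def constant_degree)
  then obtain z where z: "poly (H q) z = 0"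
    using fundamental_theorem_of_algebra by blast
  define J where "J = {f \<in> polys. poly (H f) z = 0}"
  have J: "J \<subseteq> polys" "\<And>f q g. f \<in> J \<Longrightarrow> q \<in> J \<Longrightarrow> g \<in> polys \<Longrightarrow> f - q * g \<in> J"
    by (auto simp: J_def polys_diff polys_mult H_diff H_mult)
  have "q \<in> J" using q z by (simp add: I_def J_def)
  then obtain r where r: "r \<in> J" "r \<noteq> 0" and r_min: "\<And>f. f \<in> J \<Longrightarrow> f \<noteq> 0 \<Longrightarrow> degree r \<le> degree f"
    using ex_has_least_nat[of "\<lambda>f. f \<in> J \<and> f \<noteq> 0" q degree] q by auto
  have "f \<in> J" if "f \<in> I" for f
    using min_degree_generates[OF I q q_min that] q z
    by (auto simp: I_def J_def H_mult polys_mult)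
  moreover have "f \<in> I" if "f \<in> J" for f
  proof -
    obtain g where g: "g \<in> polys" "q = r * g"
      using min_degree_generates[OF J r r_min \<open>q \<in> J\<close>] by blast
    \<comment> \<open>Minimality of both generators: the cofactor \<open>g\<close> has smaller degree than \<open>q\<close>, so that it is
      \<open>r\<close> and not \<open>g\<close> that vanishes at \<open>a\<close>.\<close>
    have "degree r \<noteq> 0"
    proof
      assume "degree r = 0"
      then have "degree (H r) = 0" using r degree_H[of r] by (auto simp: J_def)
      then have "H r = 0" using r by (auto simp: J_def elim!: degree_eq_zeroE)
      then show False using r H_eq_0_iff[of r] by (auto simp: J_def)
    qed
    moreover have "degree q = degree r + degree g"
      using g q by (auto intro!: degree_mult_eq)
    ultimately have "poly g a \<noteq> 0"
      using q_min[of g] g q by (auto simp: I_def)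
    then have "poly r a = 0" using q g by (auto simp: I_def)
    then show ?thesis
      using min_degree_generates[OF J r r_min that] that by (auto simp: I_def J_def)
  qed
  ultimately show ?thesis by (auto simp: I_def J_def)
next
  case False
  have "countable (\<Union>f\<in>polys - {0}. {z. poly (H f) z = 0})"
    using countable_polys[OF assms]
    by (intro countable_UN countable_Diff)
       (auto intro!: countable_finite poly_roots_finite simp: H_eq_0_iff)
  then obtain z where "z \<notin> (\<Union>f\<in>polys - {0}. {z. poly (H f) z = 0})"
    using uncountable_UNIV_complex by (metis UNIV_eq_I)
  with False have "\<forall>f\<in>polys. poly f a = 0 \<longleftrightarrow> poly (H f) z = 0" by auto
  then show ?thesis ..
qed

text \<open>
  An element of \<open>K(a)\<close> is a quotient \<open>f(a) / g(a)\<close>; sending it to \<open>f(z) / g(z)\<close>, with coefficients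
  transported along \<open>h\<close>, is well defined because \<open>a\<close> and \<open>z\<close> satisfy the same equations. Countability is
  kept so that the step can be repeated.
\<close>

lemma extend_by_element:
  assumes "countable K"
  shows "\<exists>K' h'. subfield_embedding K' h' \<and> countable K' \<and> K \<subseteq> K' \<and> a \<in> K'"
proof -
  obtain z where z: "\<And>f. f \<in> polys \<Longrightarrow> poly f a = 0 \<longleftrightarrow> poly (H f) z = 0"
    using ex_complex_counterpart[OF assms] by blast
  define P where "P = {(f, g). f \<in> polys \<and> g \<in> polys \<and> poly g a \<noteq> 0}"
  define val where "val = (\<lambda>(f, g). poly f a / poly g a)"
  define val' where "val' = (\<lambda>(f, g). poly (H f) z / poly (H g) z)"
  define K' where "K' = val ` P"
  define h' where "h' = (\<lambda>x. val' (SOME u. u \<in> P \<and> val u = x))"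
  have val': "val' u = val' v" if "u \<in> P" "v \<in> P" "val u = val v" for u v
  proof -
    obtain f g f' g' where uv: "u = (f, g)" "v = (f', g')" by (cases u, cases v)
    have "poly (f * g' - f' * g) a = 0"
      using that uv by (auto simp: P_def val_def field_simps)
    then have "poly (H (f * g' - f' * g)) z = 0"
      using that uv by (subst z[symmetric]) (auto simp: P_def polys_mult polys_diff)
    then show ?thesis
      using that uv z[of g] z[of g'] by (auto simp: P_def val'_def H_diff H_mult polys_mult field_simps)
  qed
  have h': "h' (val u) = val' u" if "u \<in> P" for u
  proof -
    have "\<exists>v. v \<in> P \<and> val v = val u" using that by blast
    from someI_ex[OF this] show ?thesis unfolding h'_def using that by (intro val') auto
  qed
  have c: "[:c:] \<in> polys" if "c \<in> K" for c
    using polys_monom[OF that, of 0] by (simp add: monom_0)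
  have Kval: "(([:c:], [:1:]) \<in> P) \<and> val ([:c:], [:1:]) = c" if "c \<in> K" for c
    using c[OF that] c[OF one_mem] by (simp add: P_def val_def)
  have "monom 1 1 \<in> polys" by (rule polys_monom[OF one_mem])
  then have aval: "(monom 1 1, [:1:]) \<in> P \<and> val (monom 1 1, [:1:]) = a"
    using c[OF one_mem] by (simp add: P_def val_def poly_monom)
  have sums: "\<exists>w\<in>P. val w = val u + val v \<and> val' w = val' u + val' v"
    and diffs: "\<exists>w\<in>P. val w = val u - val v"
    and prods: "\<exists>w\<in>P. val w = val u * val v \<and> val' w = val' u * val' v"
    if "u \<in> P" "v \<in> P" for u v
  proof -
    obtain f g f' g' where uv: "u = (f, g)" "v = (f', g')" by (cases u, cases v)
    have nz: "poly g a \<noteq> 0" "poly g' a \<noteq> 0" "poly (H g) z \<noteq> 0" "poly (H g') z \<noteq> 0"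
      using that z by (auto simp: P_def uv)
    show "\<exists>w\<in>P. val w = val u + val v \<and> val' w = val' u + val' v"
      by (rule bexI[of _ "(f * g' + f' * g, g * g')"])
         (use that nz in \<open>auto simp: P_def uv val_def val'_def polys_mult polys_add H_add H_mult
           add_frac_eq\<close>)
    show "\<exists>w\<in>P. val w = val u - val v"
      by (rule bexI[of _ "(f * g' - f' * g, g * g')"])
         (use that nz in \<open>auto simp: P_def uv val_def polys_mult polys_diff diff_frac_eq\<close>)
    show "\<exists>w\<in>P. val w = val u * val v \<and> val' w = val' u * val' v"
      by (rule bexI[of _ "(f * f', g * g')"])
         (use that nz in \<open>auto simp: P_def uv val_def val'_def polys_mult H_mult\<close>)
  qed
  have "subfield_embedding K' h'"
  proof
    show "1 \<in> K'" using Kval[OF one_mem] by (force simp: K'_def)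
    show "h' 1 = 1"
      using Kval[OF one_mem] h'[of "([:1:], [:1:])"] h_one
      by (simp add: val'_def map_poly_pCons h_zero)
    fix x assume "x \<in> K'"
    then obtain u where u: "u \<in> P" "x = val u" by (auto simp: K'_def)
    obtain f g where fg: "u = (f, g)" by force
    show "inverse x \<in> K'"
    proof (cases "poly f a = 0")
      case True
      then have "x = 0" by (simp add: u fg val_def)
      then show ?thesis using Kval[OF zero_mem] by (force simp: K'_def)
    next
      case False
      then have "(g, f) \<in> P" "inverse x = val (g, f)"
        using u fg by (auto simp: P_def val_def)
      then show ?thesis by (simp add: K'_def)
    qed
    fix y assume "y \<in> K'"
    then obtain v where v: "v \<in> P" "y = val v" by (auto simp: K'_def)
    show "x - y \<in> K'" using diffs[OF u(1) v(1)] by (force simp: u v K'_def)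
    show "x * y \<in> K'" using prods[OF u(1) v(1)] by (force simp: u v K'_def)
    show "h' (x + y) = h' x + h' y" using sums[OF u(1) v(1)] h' u v by metis
    show "h' (x * y) = h' x * h' y" using prods[OF u(1) v(1)] h' u v by metis
  qed
  moreover have "countable K'"
  proof -
    have "P \<subseteq> polys \<times> polys" by (auto simp: P_def)
    then show ?thesis
      unfolding K'_def using countable_polys[OF assms] by (meson countable_SIGMA countable_image countable_subset)
  qed
  moreover have "K \<subseteq> K'" using Kval by (force simp: K'_def)
  moreover have "a \<in> K'" using aval by (force simp: K'_def)
  ultimately show ?thesis by blast
qed

end

lemma subfield_embedding_Rats:
  "subfield_embedding (\<rat> :: 'a::field_char_0 set) (\<lambda>x. of_rat (SOME r. x = of_rat r))"
proof -
  have "(SOME r'. (of_rat r :: 'a) = of_rat r') = r" for r by (rule some_equality) auto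
  then have h: "of_rat (SOME r'. (of_rat r :: 'a) = of_rat r') = (of_rat r :: complex)" for r by simp
  show ?thesis
  proof
    show "of_rat (SOME r. (1::'a) = of_rat r) = (1::complex)" using h[of 1] by simp
    fix x y :: 'a assume "x \<in> \<rat>" "y \<in> \<rat>"
    then obtain r s where rs: "x = of_rat r" "y = of_rat s" by (auto elim!: Rats_cases)
    show "of_rat (SOME r. x + y = of_rat r) =
        (of_rat (SOME r. x = of_rat r) + of_rat (SOME r. y = of_rat r) :: complex)"
      using h[of "r + s"] h[of r] h[of s] by (simp add: rs of_rat_add)
    show "of_rat (SOME r. x * y = of_rat r) =
        (of_rat (SOME r. x = of_rat r) * of_rat (SOME r. y = of_rat r) :: complex)"
      using h[of "r * s"] h[of r] h[of s] by (simp add: rs of_rat_mult)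
  qed auto
qed

lemma ex_subfield_embedding:
  assumes "finite S"
  shows "\<exists>K h. subfield_embedding K h \<and> (S :: 'a::field_char_0 set) \<subseteq> K"
proof -
  have "\<exists>K h. subfield_embedding K h \<and> countable K \<and> S \<subseteq> K"
    using assms
  proof induction
    case empty
    then show ?case using subfield_embedding_Rats countable_rat by blast
  next
    case (insert a S)
    then show ?case by (meson insert_subset order_trans subfield_embedding.extend_by_element)
  qed
  then show ?thesis by blast
qed

section \<open>Tensoring with the regular representation of the quotient\<close>

definition entries2 :: "'a mat2 \<Rightarrow> 'a set" where
  "entries2 = (\<lambda>(a, b, c, d). {a, b, c, d})"

definition map2 :: "('a \<Rightarrow> 'b) \<Rightarrow> 'a mat2 \<Rightarrow> 'b mat2" where
  "map2 f = (\<lambda>(a, b, c, d). (f a, f b, f c, f d))"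

lemma entries2_simp [simp]: "entries2 (a, b, c, d) = {a, b, c, d}"
  by (simp add: entries2_def)

lemma map2_simp [simp]: "map2 f (a, b, c, d) = (f a, f b, f c, f d)"
  by (simp add: map2_def)

text \<open>The Kronecker product, written in blocks so that its products and determinants reduce to those of block matrices.\<close>

definition kronecker2 :: "'a::comm_ring_1 mat2 \<Rightarrow> 'a mat \<Rightarrow> 'a mat" where
  "kronecker2 = (\<lambda>(a, b, c, d) P. four_block_mat (a \<cdot>\<^sub>m P) (b \<cdot>\<^sub>m P) (c \<cdot>\<^sub>m P) (d \<cdot>\<^sub>m P))"

lemma kronecker2_carrier:
  "P \<in> carrier_mat N N \<Longrightarrow> kronecker2 A P \<in> carrier_mat (2 * N) (2 * N)"
  by (cases A) (auto simp: kronecker2_def mult_2)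

lemma kronecker2_mult:
  assumes "P \<in> carrier_mat N N" "Q \<in> carrier_mat N N"
  shows "kronecker2 A P * kronecker2 B Q = kronecker2 (mult2 A B) (P * Q)"
proof -
  obtain a b c d where A: "A = (a, b, c, d)" by (metis prod_cases4)
  obtain a' b' c' d' where B: "B = (a', b', c', d')" by (metis prod_cases4)
  have "(x \<cdot>\<^sub>m P) * (y \<cdot>\<^sub>m Q) + (x' \<cdot>\<^sub>m P) * (y' \<cdot>\<^sub>m Q) = (x * y + x' * y') \<cdot>\<^sub>m (P * Q)" for x y x' y'
    using assms by (intro eq_matI) (auto simp: algebra_simps)
  then show ?thesis
    unfolding A B kronecker2_def split mult2_simp using assms
    by (subst mult_four_block_mat) auto
qed

text \<open>
  The four blocks are multiples of \<open>P\<close> and commute, so the determinant is that of the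
  block expression \<open>(a d - b c) P\<^sup>2\<close>.
\<close>

lemma det_kronecker2:
  fixes P :: "'a::idom mat"
  assumes "P \<in> carrier_mat N N"
  shows "det (kronecker2 A P) = det2 A ^ N * (det P)\<^sup>2"
proof -
  obtain a b c d where A: "A = (a, b, c, d)" by (metis prod_cases4)
  have "(x \<cdot>\<^sub>m P) * (y \<cdot>\<^sub>m P) = (x * y) \<cdot>\<^sub>m (P * P)" for x y
    using assms by (intro eq_matI) (auto simp: algebra_simps)
  then have "det (kronecker2 A P) = det ((a * d) \<cdot>\<^sub>m (P * P) - (b * c) \<cdot>\<^sub>m (P * P))"
    unfolding A kronecker2_def split using assms
    by (subst det_four_block_mat[of _ N]) (auto simp: mult.commute)
  also have "(a * d) \<cdot>\<^sub>m (P * P) - (b * c) \<cdot>\<^sub>m (P * P) = det2 A \<cdot>\<^sub>m (P * P)"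
    using assms by (intro eq_matI) (auto simp: A algebra_simps)
  also have "det \<dots> = det2 A ^ N * (det P)\<^sup>2"
    using assms det_mult[OF assms assms] by (simp add: power2_eq_square)
  finally show ?thesis .
qed

lemma index_kronecker2:
  assumes "P \<in> carrier_mat N N" "i < 2 * N" "j < 2 * N"
  shows "kronecker2 (a, b, c, d) P $$ (i, j) =
    (if i < N then if j < N then a * P $$ (i, j) else b * P $$ (i, j - N)
     else if j < N then c * P $$ (i - N, j) else d * P $$ (i - N, j - N))"
  using assms by (auto simp: kronecker2_def mult_2)

lemma kronecker2_entry_mem:
  assumes P: "P \<in> carrier_mat N N" "\<And>k l. k < N \<Longrightarrow> l < N \<Longrightarrow> P $$ (k, l) = 0 \<or> P $$ (k, l) = 1"
    and R: "entries2 A \<subseteq> R" "0 \<in> R" and ij: "i < 2 * N" "j < 2 * N"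
  shows "kronecker2 A P $$ (i, j) \<in> R"
proof -
  obtain a b c d where A: "A = (a, b, c, d)" by (metis prod_cases4)
  have "t * P $$ (k, l) \<in> R" if "t \<in> R" "k < N" "l < N" for t k l
    using P(2)[OF that(2,3)] that(1) R(2) by auto
  then show ?thesis
    using R(1) ij unfolding A index_kronecker2[OF P(1) ij] by auto
qed

text \<open>The permutation matrix of left multiplication by \<open>x\<close>, in the enumeration \<open>e\<close> of the group \<open>Q\<close>.\<close>

definition regular_mat :: "('q, 'm) monoid_scheme \<Rightarrow> nat \<Rightarrow> (nat \<Rightarrow> 'q) \<Rightarrow> 'q \<Rightarrow> 'a::comm_ring_1 mat" where
  "regular_mat Q N e x = mat N N (\<lambda>(i, j). if e i = x \<otimes>\<^bsub>Q\<^esub> e j then 1 else 0)"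

lemma regular_mat_carrier [simp]: "regular_mat Q N e x \<in> carrier_mat N N"
  by (simp add: regular_mat_def)

lemma regular_mat_mult:
  assumes "group Q" and e: "bij_betw e {0..<N} (carrier Q)"
    and x: "x \<in> carrier Q" and y: "y \<in> carrier Q"
  shows "regular_mat Q N e (x \<otimes>\<^bsub>Q\<^esub> y) = (regular_mat Q N e x * regular_mat Q N e y :: 'a::comm_ring_1 mat)"
proof (rule eq_matI)
  interpret group Q by fact
  let ?M = "regular_mat Q N e :: _ \<Rightarrow> 'a mat"
  fix i j assume "i < dim_row (?M x * ?M y)" "j < dim_col (?M x * ?M y)"
  then have ij: "i < N" "j < N" by (auto simp: regular_mat_def)
  have ej: "e k \<in> carrier Q" if "k < N" for k
    using bij_betwE[OF e] that by simp
  \<comment> \<open>The only nonzero summand of the matrix product is at the index \<open>k\<close> of \<open>y \<otimes> e j\<close>.\<close>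
  obtain k where k: "k < N" "e k = y \<otimes>\<^bsub>Q\<^esub> e j"
    using e y ej[OF ij(2)] by (metis atLeastLessThan_iff bij_betw_iff_bijections m_closed)
  have k_iff: "e l = y \<otimes>\<^bsub>Q\<^esub> e j \<longleftrightarrow> l = k" if "l < N" for l
    using inj_on_eq_iff[OF bij_betw_imp_inj_on[OF e], of l k] that k by simp
  have "(?M x * ?M y) $$ (i, j) =
      (\<Sum>l = 0..<N. (if e i = x \<otimes>\<^bsub>Q\<^esub> e l then 1 else 0) * (if l = k then 1 else 0 :: 'a))"
    using ij by (auto simp: regular_mat_def scalar_prod_def k_iff intro!: sum.cong)
  also have "\<dots> = (if e i = x \<otimes>\<^bsub>Q\<^esub> e k then 1 else 0)"
    using k by (simp add: if_distrib[of "\<lambda>u. _ * u"] cong: if_cong)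
  also have "\<dots> = ?M (x \<otimes>\<^bsub>Q\<^esub> y) $$ (i, j)"
    using ij k x y ej by (simp add: regular_mat_def m_assoc)
  finally show "?M (x \<otimes>\<^bsub>Q\<^esub> y) $$ (i, j) = (?M x * ?M y) $$ (i, j)" ..
qed (auto simp: regular_mat_def)

lemma regular_mat_eq_one_iff:
  fixes N :: nat
  assumes "group Q" and e: "bij_betw e {0..<N} (carrier Q)" and x: "x \<in> carrier Q"
  shows "(\<forall>i<N. \<forall>j<N. (e i = x \<otimes>\<^bsub>Q\<^esub> e j) = (i = j)) \<longleftrightarrow> x = \<one>\<^bsub>Q\<^esub>"
proof -
  interpret group Q by fact
  have ej: "e k \<in> carrier Q" if "k < N" for k
    using bij_betwE[OF e] that by simp
  obtain k where k: "k < N" "e k = \<one>\<^bsub>Q\<^esub>"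
    using e by (metis atLeastLessThan_iff bij_betw_iff_bijections one_closed)
  have "x = \<one>\<^bsub>Q\<^esub>" if "\<forall>i<N. \<forall>j<N. (e i = x \<otimes>\<^bsub>Q\<^esub> e j) = (i = j)"
    using that k x by (metis r_one)
  moreover have "(e i = e j) = (i = j)" if "i < N" "j < N" for i j
    using inj_on_eq_iff[OF bij_betw_imp_inj_on[OF e]] that by simp
  ultimately show ?thesis using ej by auto
qed

text \<open>The inverse of a permutation matrix is its transpose, which has the same determinant.\<close>

lemma det_regular_mat_sq:
  assumes "group Q" and e: "bij_betw e {0..<N} (carrier Q)" and x: "x \<in> carrier Q"
  shows "(det (regular_mat Q N e x :: 'a::comm_ring_1 mat))\<^sup>2 = 1"
proof -
  interpret group Q by fact
  let ?M = "regular_mat Q N e :: _ \<Rightarrow> 'a mat"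
  have ej: "e k \<in> carrier Q" if "k < N" for k
    using bij_betwE[OF e] that by simp
  have "?M (inv\<^bsub>Q\<^esub> x) = transpose_mat (?M x)"
  proof (rule eq_matI)
    fix i j assume "i < dim_row (transpose_mat (?M x))" "j < dim_col (transpose_mat (?M x))"
    then have ij: "i < N" "j < N" by (auto simp: regular_mat_def)
    then have "e i = inv\<^bsub>Q\<^esub> x \<otimes>\<^bsub>Q\<^esub> e j \<longleftrightarrow> e j = x \<otimes>\<^bsub>Q\<^esub> e i"
      using x ej by (metis inv_closed inv_solve_left inv_inv)
    then show "?M (inv\<^bsub>Q\<^esub> x) $$ (i, j) = transpose_mat (?M x) $$ (i, j)"
      using ij by (simp add: regular_mat_def)
  qed (auto simp: regular_mat_def)
  then have "det (?M x) * det (?M x) = det (?M x * ?M (inv\<^bsub>Q\<^esub> x))"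
    by (simp add: det_mult[of _ N] det_transpose[of _ N])
  also have "?M x * ?M (inv\<^bsub>Q\<^esub> x) = ?M \<one>\<^bsub>Q\<^esub>"
    using regular_mat_mult[OF assms(1) e x, of "inv\<^bsub>Q\<^esub> x", where 'a = 'a] x by simp
  also have "\<dots> = 1\<^sub>m N"
    using regular_mat_eq_one_iff[OF assms(1) e one_closed]
    by (intro eq_matI) (auto simp: regular_mat_def)
  finally show ?thesis by (simp add: power2_eq_square)
qed

text \<open>
  The witness is \<open>g \<mapsto> \<sigma> g \<otimes> P (\<Delta> g)\<close>, where \<open>P\<close> is the regular representation of \<open>\<Gamma> / \<Delta>\<close>.
  It is faithful since \<open>\<sigma>\<close> is, its determinant is \<open>det P (\<Delta> g)\<^sup>2 = 1\<close>, and it reduces to two copies of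
  the regular representation of \<open>\<Gamma> / \<Delta>\<close> because \<open>\<sigma>\<close> reduces to the identity.
\<close>

lemma ex_rep_with_reduction_kernel:
  fixes \<sigma> :: "'a \<Rightarrow> complex mat2"
  assumes \<Gamma>: "group \<Gamma>" and \<Delta>: "\<Delta> \<lhd> \<Gamma>" and fin: "finite (rcosets\<^bsub>\<Gamma>\<^esub> \<Delta>)"
    and R: "subdomain R (class_ring :: complex ring)"
    and \<theta>: "ring_hom_ring (complex_subring R) (residue_ring q) \<theta>"
    and surj: "\<theta> ` R = carrier (residue_ring q)"
    and entries: "\<And>g. g \<in> carrier \<Gamma> \<Longrightarrow> entries2 (\<sigma> g) \<subseteq> R"
    and reduct: "\<And>g. g \<in> carrier \<Gamma> \<Longrightarrow> map2 \<theta> (\<sigma> g) = one2"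
    and det: "\<And>g. g \<in> carrier \<Gamma> \<Longrightarrow> det2 (\<sigma> g) = 1"
    and mult: "\<And>g h. g \<in> carrier \<Gamma> \<Longrightarrow> h \<in> carrier \<Gamma> \<Longrightarrow> \<sigma> (g \<otimes>\<^bsub>\<Gamma>\<^esub> h) = mult2 (\<sigma> g) (\<sigma> h)"
    and inj: "inj_on \<sigma> (carrier \<Gamma>)"
  shows "\<exists>m \<phi> \<rho>.
    ideal m (complex_subring R) \<and>
    \<phi> \<in> ring_iso (complex_subring R Quot m) (residue_ring q) \<and>
    \<rho> \<in> hom \<Gamma> (SL (2 * card (rcosets\<^bsub>\<Gamma>\<^esub> \<Delta>)) (complex_subring R)) \<and>
    inj_on \<rho> (carrier \<Gamma>) \<and>
    \<Delta> = kernel \<Gamma> (SL (2 * card (rcosets\<^bsub>\<Gamma>\<^esub> \<Delta>)) (residue_ring q))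
          (mat_reduction (complex_subring R) m \<phi> \<circ> \<rho>)"
proof -
  interpret \<Gamma>: group \<Gamma> by fact
  interpret \<Delta>: normal \<Delta> \<Gamma> by fact
  have zero_R: "0 \<in> R" using subdomainE(2)[OF R] by (simp add: class_ring_simps)
  define N where "N = card (rcosets\<^bsub>\<Gamma>\<^esub> \<Delta>)"
  define Q where "Q = \<Gamma> Mod \<Delta>"
  have Q: "group Q" unfolding Q_def by (rule \<Delta>.factorgroup_is_group)
  interpret Q: group Q by fact
  have carrier_Q: "carrier Q = rcosets\<^bsub>\<Gamma>\<^esub> \<Delta>" by (simp add: Q_def FactGroup_def)
  obtain e where e: "bij_betw e {0..<N} (carrier Q)"
    using ex_bij_betw_nat_finite[OF fin] unfolding N_def carrier_Q by blast
  define x where "x = (\<lambda>g. \<Delta> #>\<^bsub>\<Gamma>\<^esub> g)"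
  have x_mem: "x g \<in> carrier Q" if "g \<in> carrier \<Gamma>" for g
    using that \<Delta>.subset by (simp add: x_def carrier_Q \<Gamma>.rcosetsI)
  have x_mult: "x (g \<otimes>\<^bsub>\<Gamma>\<^esub> h) = x g \<otimes>\<^bsub>Q\<^esub> x h" if "g \<in> carrier \<Gamma>" "h \<in> carrier \<Gamma>" for g h
    using that by (simp add: x_def Q_def FactGroup_def \<Delta>.rcos_sum)
  have x_one: "x g = \<one>\<^bsub>Q\<^esub> \<longleftrightarrow> g \<in> \<Delta>" if "g \<in> carrier \<Gamma>" for g
    using that \<Gamma>.coset_join1[of \<Delta> g] \<Gamma>.coset_join2[of g \<Delta>] \<Delta>.subgroup_axioms
    by (auto simp: x_def Q_def FactGroup_def)
  define P where "P = (\<lambda>g. regular_mat Q N e (x g) :: complex mat)"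
  have P: "P g \<in> carrier_mat N N" for g by (simp add: P_def)
  have P_entry: "P g $$ (i, j) = (if e i = x g \<otimes>\<^bsub>Q\<^esub> e j then 1 else 0)" if "i < N" "j < N" for g i j
    using that by (simp add: P_def regular_mat_def)
  define \<rho> where "\<rho> = (\<lambda>g. kronecker2 (\<sigma> g) (P g))"
  have \<rho>_carrier: "\<rho> g \<in> carrier_mat (2 * N) (2 * N)" for g
    by (simp add: \<rho>_def kronecker2_carrier P)
  have \<rho>_entry: "\<rho> g $$ (i, j) =
      (if i < N then if j < N then a * P g $$ (i, j) else b * P g $$ (i, j - N)
       else if j < N then c * P g $$ (i - N, j) else d * P g $$ (i - N, j - N))"
    if "\<sigma> g = (a, b, c, d)" "i < 2 * N" "j < 2 * N" for g a b c d i j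
    unfolding \<rho>_def that(1) by (rule index_kronecker2[OF P that(2,3)])
  have \<rho>_entry_mem: "\<rho> g $$ (i, j) \<in> R" if "g \<in> carrier \<Gamma>" "i < 2 * N" "j < 2 * N" for g i j
    unfolding \<rho>_def
    by (rule kronecker2_entry_mem[OF P _ entries[OF that(1)] zero_R that(2,3)]) (simp add: P_entry)
  have \<rho>_SL: "\<rho> g \<in> carrier (SL (2 * N) (complex_subring R))" if g: "g \<in> carrier \<Gamma>" for g
  proof -
    have "elements_mat (\<rho> g) \<subseteq> R"
      using \<rho>_entry_mem[OF g] \<rho>_carrier[of g] by (auto dest!: elements_matD)
    moreover have "Determinant.det (\<rho> g) = 1"
      unfolding \<rho>_def det_kronecker2[OF P] det[OF g]
      by (simp add: P_def det_regular_mat_sq[OF Q e x_mem[OF g]])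
    ultimately show ?thesis
      unfolding SL_complex_subring(1)[OF R] using \<rho>_carrier by simp
  qed
  have hom: "\<rho> \<in> hom \<Gamma> (SL (2 * N) (complex_subring R))"
  proof (rule homI)
    fix g h assume gh: "g \<in> carrier \<Gamma>" "h \<in> carrier \<Gamma>"
    have "P (g \<otimes>\<^bsub>\<Gamma>\<^esub> h) = P g * P h"
      using gh by (simp add: P_def x_mult regular_mat_mult[OF Q e] x_mem)
    then have "\<rho> (g \<otimes>\<^bsub>\<Gamma>\<^esub> h) = \<rho> g * \<rho> h"
      using gh by (simp add: \<rho>_def kronecker2_mult[OF P P] mult)
    then show "\<rho> (g \<otimes>\<^bsub>\<Gamma>\<^esub> h) = \<rho> g \<otimes>\<^bsub>SL (2 * N) (complex_subring R)\<^esub> \<rho> h"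
      unfolding SL_complex_subring(2)[OF R \<rho>_SL[OF gh(1)] \<rho>_SL[OF gh(2)]] .
  qed (rule \<rho>_SL)
  have inj_\<rho>: "inj_on \<rho> (carrier \<Gamma>)"
  proof (rule inj_onI)
    fix g h assume gh: "g \<in> carrier \<Gamma>" "h \<in> carrier \<Gamma>" "\<rho> g = \<rho> h"
    obtain a b c d where g: "\<sigma> g = (a, b, c, d)" by (metis prod_cases4)
    obtain a' b' c' d' where h: "\<sigma> h = (a', b', c', d')" by (metis prod_cases4)
    obtain j where j: "j < N" "e j = \<one>\<^bsub>Q\<^esub>"
      using e by (metis atLeastLessThan_iff bij_betw_iff_bijections Q.one_closed)
    obtain i where i: "i < N" "e i = x g"
      using e x_mem[OF gh(1)] by (metis atLeastLessThan_iff bij_betw_iff_bijections)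
    \<comment> \<open>At this position the permutation matrix of \<open>g\<close> has an entry one, so the four
      corresponding entries of \<open>\<rho> g\<close> are those of \<open>\<sigma> g\<close>.\<close>
    have one: "P g $$ (i, j) = 1" using i j x_mem[OF gh(1)] by (simp add: P_entry)
    define t where "t = P h $$ (i, j)"
    have t: "t = 0 \<or> t = 1" using i j by (simp add: t_def P_entry)
    have eq: "\<rho> g $$ (k, l) = \<rho> h $$ (k, l)" for k l by (simp add: gh(3))
    have "a = a' * t" "b = b' * t" "c = c' * t" "d = d' * t"
      using eq[of i j] eq[of i "j + N"] eq[of "i + N" j] eq[of "i + N" "j + N"] i j one
      by (simp_all add: \<rho>_entry[OF g] \<rho>_entry[OF h] t_def)
    moreover have "a * d - b * c = 1" using det[OF gh(1)] g by simp
    ultimately have "\<sigma> g = \<sigma> h" using t g h by auto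
    then show "g = h" using inj gh by (auto dest: inj_onD)
  qed
  define m where "m = a_kernel (complex_subring R) (residue_ring q) \<theta>"
  define \<phi> where "\<phi> = (\<lambda>X. the_elem (\<theta> ` X))"
  have ideal: "ideal m (complex_subring R)" unfolding m_def by (rule ring_hom_ring.kernel_is_ideal[OF \<theta>])
  have iso: "\<phi> \<in> ring_iso (complex_subring R Quot m) (residue_ring q)"
    unfolding m_def \<phi>_def by (rule ring_hom_ring.FactRing_iso_set[OF \<theta>]) (simp add: surj)
  have red_entry: "mat_reduction (complex_subring R) m \<phi> (\<rho> g) $$ (i, j) = \<theta> (\<rho> g $$ (i, j))"
    if "g \<in> carrier \<Gamma>" "i < 2 * N" "j < 2 * N" for g i j
    using that \<rho>_carrier[of g] ring_hom_ring.the_elem_simp[OF \<theta>, of "\<rho> g $$ (i, j)"] \<rho>_entry_mem[of g i j]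
    by (simp add: mat_reduction_def m_def \<phi>_def)
  have \<theta>_0: "\<theta> 0 = 0" using ring_hom_zero[OF ring_hom_ring.homh[OF \<theta>] ring_hom_ring.axioms(1,2)[OF \<theta>]]
    by (simp add: class_ring_simps residue_ring_def)
  have red: "mat_reduction (complex_subring R) m \<phi> (\<rho> g) $$ (i, j) =
      (if (i < N) = (j < N) \<and> e (i mod N) = x g \<otimes>\<^bsub>Q\<^esub> e (j mod N) then 1 else 0)"
    if g: "g \<in> carrier \<Gamma>" and ij: "i < 2 * N" "j < 2 * N" for g i j
  proof -
    obtain a b c d where s: "\<sigma> g = (a, b, c, d)" by (metis prod_cases4)
    have \<theta>s: "\<theta> a = 1" "\<theta> b = 0" "\<theta> c = 0" "\<theta> d = 1"
      using reduct[OF g] by (simp_all add: s one2_def)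
    have md: "k mod N = (if k < N then k else k - N)" if "k < 2 * N" for k
      using that by (auto simp: le_mod_geq)
    show ?thesis
      unfolding red_entry[OF g ij] \<rho>_entry[OF s ij] md[OF ij(1)] md[OF ij(2)]
      using ij by (auto simp: P_entry \<theta>s \<theta>_0)
  qed
  have "mat_reduction (complex_subring R) m \<phi> (\<rho> g) = \<one>\<^bsub>SL (2 * N) (residue_ring q)\<^esub> \<longleftrightarrow> g \<in> \<Delta>"
    if g: "g \<in> carrier \<Gamma>" for g
  proof -
    let ?M = "mat_reduction (complex_subring R) m \<phi> (\<rho> g)"
    have one_entry: "\<one>\<^bsub>SL (2 * N) (residue_ring q)\<^esub> $$ (i, j) = (if i = j then 1 else 0)"
      if "i < 2 * N" "j < 2 * N" for i j
      using that by (simp add: SL_def residue_ring_def)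
    have "?M = \<one>\<^bsub>SL (2 * N) (residue_ring q)\<^esub>" if "g \<in> \<Delta>"
    proof (rule eq_matI)
      fix i j assume "i < dim_row \<one>\<^bsub>SL (2 * N) (residue_ring q)\<^esub>"
        "j < dim_col \<one>\<^bsub>SL (2 * N) (residue_ring q)\<^esub>"
      then have ij: "i < 2 * N" "j < 2 * N" by (simp_all add: SL_def)
      then have "N > 0" by simp
      have "e (i mod N) = x g \<otimes>\<^bsub>Q\<^esub> e (j mod N) \<longleftrightarrow> i mod N = j mod N"
        using regular_mat_eq_one_iff[OF Q e x_mem[OF g]] x_one[OF g] \<open>g \<in> \<Delta>\<close> \<open>N > 0\<close> by simp
      moreover have "(i < N) = (j < N) \<and> i mod N = j mod N \<longleftrightarrow> i = j"
        using ij by (auto simp: le_mod_geq not_less)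
      ultimately show "?M $$ (i, j) = \<one>\<^bsub>SL (2 * N) (residue_ring q)\<^esub> $$ (i, j)"
        unfolding red[OF g ij] one_entry[OF ij] by simp
    qed (use \<rho>_carrier[of g] in \<open>auto simp: SL_def mat_reduction_def\<close>)
    moreover have "g \<in> \<Delta>" if eq: "?M = \<one>\<^bsub>SL (2 * N) (residue_ring q)\<^esub>"
    proof -
      have "(e i = x g \<otimes>\<^bsub>Q\<^esub> e j) = (i = j)" if "i < N" "j < N" for i j
        using red[OF g, of i j] one_entry[of i j] that unfolding eq by (auto split: if_splits)
      then have "x g = \<one>\<^bsub>Q\<^esub>"
        using regular_mat_eq_one_iff[OF Q e x_mem[OF g]] by blast
      then show ?thesis using x_one[OF g] by simp
    qed
    ultimately show ?thesis by blast
  qed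
  then have "\<Delta> = kernel \<Gamma> (SL (2 * N) (residue_ring q)) (mat_reduction (complex_subring R) m \<phi> \<circ> \<rho>)"
    using \<Delta>.subset by (auto simp: kernel_def)
  then show ?thesis
    using ideal iso hom inj_\<rho> unfolding N_def by blast
qed

section \<open>Transporting the ultraproduct representation to the complex numbers\<close>

definition hyper2 :: "(nat \<Rightarrow> int mat2) \<Rightarrow> hyperrat mat2" where
  "hyper2 A = (hyper (\<lambda>n. fst (A n)), hyper (\<lambda>n. fst (snd (A n))),
    hyper (\<lambda>n. fst (snd (snd (A n)))), hyper (\<lambda>n. snd (snd (snd (A n)))))"

lemma hyper2_mult: "hyper2 (\<lambda>n. mult2 (A n) (B n)) = mult2 (hyper2 A) (hyper2 B)"
  by (simp add: hyper2_def hyper_simps mult2_def case_prod_beta)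

lemma det2_hyper2: "det2 (hyper2 A) = hyper (\<lambda>n. det2 (A n))"
  by (simp add: hyper2_def hyper_simps det2_def case_prod_beta)

lemma hyper2_one_iff: "hyper2 A = one2 \<longleftrightarrow> eventually (\<lambda>n. A n = one2) ultra"
  by (simp add: hyper2_def one2_def hyper_simps hyper_eq_iff prod_eq_iff eventually_conj_iff)

lemma entries2_hyper2: "entries2 (hyper2 A) \<subseteq> range hyper"
  by (simp add: hyper2_def)

text \<open>
  The integral elements of the subfield \<open>K\<close> reduce modulo \<open>q\<close> componentwise, and \<open>h\<close> carries this reduction
  over to their complex images because it is injective on \<open>K\<close>. The reduction is onto since
  \<open>K\<close> contains the integers.
\<close>

lemma hyper_image_residue_hom:
  assumes "subfield_embedding K h" "q > 1"
  defines "R \<equiv> h ` (K \<inter> range hyper)" and "\<theta> \<equiv> \<lambda>z. hyper_mod q (inv_into K h z)"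
  shows "subdomain R (class_ring :: complex ring)"
    and "ring_hom_ring (complex_subring R) (residue_ring q) \<theta>"
    and "\<theta> ` R = carrier (residue_ring q)"
proof -
  interpret subfield_embedding K h by fact
  interpret residues q "residue_ring q"
    using assms(2) by (simp add: residues_def)
  have hyper_ring: "x + y \<in> range hyper" "x * y \<in> range hyper" "- x \<in> range hyper"
    if "x \<in> range hyper" "y \<in> range hyper" for x y
    using that by (auto simp: hyper_simps)
  have hyper_one: "1 \<in> range hyper" by (auto simp: hyper_simps)
  have h_uminus: "h (- x) = - h x" if "x \<in> K" for x
    using h_diff[OF zero_mem that] h_zero by simp
  show R: "subdomain R (class_ring :: complex ring)"
  proof (rule ring.subdomainI[OF class_ring.ring_axioms
        ring.subcringI[OF class_ring.ring_axioms ring.subringI[OF class_ring.ring_axioms]]])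
    show "\<one>\<^bsub>class_ring\<^esub> \<in> R"
      using one_mem hyper_one h_one by (force simp: R_def class_ring_simps)
    fix z w :: complex assume z: "z \<in> R"
    then obtain x where x: "x \<in> K" "x \<in> range hyper" "z = h x" by (auto simp: R_def)
    have "- z = h (- x)" "- x \<in> K \<inter> range hyper"
      using x hyper_ring(3)[OF x(2,2)] uminus_mem h_uminus by auto
    then show "\<ominus>\<^bsub>class_ring\<^esub> z \<in> R" by (simp add: R_def class_ring_simps)
    assume w: "w \<in> R"
    then obtain y where y: "y \<in> K" "y \<in> range hyper" "w = h y" by (auto simp: R_def)
    have "z * w = h (x * y)" "x * y \<in> K \<inter> range hyper" "z + w = h (x + y)" "x + y \<in> K \<inter> range hyper"
      using x y hyper_ring(1,2)[OF x(2) y(2)] add_mem mult_mem h_add h_mult by auto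
    then show "z \<otimes>\<^bsub>class_ring\<^esub> w \<in> R" "z \<oplus>\<^bsub>class_ring\<^esub> w \<in> R"
      by (simp_all add: R_def class_ring_simps)
  qed (auto simp: class_ring_simps)
  have \<theta>: "\<theta> (h x) = hyper_mod q x" if "x \<in> K" for x
    using that inj_on_h by (simp add: \<theta>_def)
  have q: "q > 0" using assms(2) by simp
  show "ring_hom_ring (complex_subring R) (residue_ring q) \<theta>"
  proof (rule ring_hom_ringI)
    show "ring (complex_subring R)"
      using subdomain_complex_cring[OF R] by (simp add: cring_def)
    show "ring (residue_ring q)" by (rule ring_axioms)
    show "\<theta> \<one>\<^bsub>complex_subring R\<^esub> = \<one>\<^bsub>residue_ring q\<^esub>"
      using \<theta>[OF one_mem] h_one hyper_mod_const[of q 1] assms(2)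
      by (simp add: res_one_eq class_ring_simps hyper_simps(6))
    fix z w assume "z \<in> carrier (complex_subring R)"
    then obtain a where x: "hyper a \<in> K" "z = h (hyper a)" by (auto simp: R_def)
    show "\<theta> z \<in> carrier (residue_ring q)"
      using hyper_mod_hom(1)[OF q, of a] by (simp add: x \<theta> res_carrier_eq)
    assume "w \<in> carrier (complex_subring R)"
    then obtain b where y: "hyper b \<in> K" "w = h (hyper b)" by (auto simp: R_def)
    show "\<theta> (z \<otimes>\<^bsub>complex_subring R\<^esub> w) = \<theta> z \<otimes>\<^bsub>residue_ring q\<^esub> \<theta> w"
      using hyper_mod_hom(3)[OF q, of a b] mult_mem[OF x(1) y(1)]
      by (simp add: x y \<theta> res_mult_eq flip: h_mult)
    show "\<theta> (z \<oplus>\<^bsub>complex_subring R\<^esub> w) = \<theta> z \<oplus>\<^bsub>residue_ring q\<^esub> \<theta> w"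
      using hyper_mod_hom(2)[OF q, of a b] add_mem[OF x(1) y(1)]
      by (simp add: x y \<theta> res_add_eq flip: h_add)
  qed
  then interpret \<theta>: ring_hom_ring "complex_subring R" "residue_ring q" \<theta> .
  have int_mem: "of_int k \<in> K" for k
    by (induction k rule: int_induct[of _ 0])
       (auto simp: zero_mem add_mem diff_mem one_mem)
  have "k \<in> \<theta> ` R" if "k \<in> carrier (residue_ring q)" for k
  proof (rule image_eqI)
    show "h (of_int k) \<in> R"
      using int_mem[of k] by (auto simp: R_def of_int_hyperrat)
    show "k = \<theta> (h (of_int k))"
      using that hyper_mod_const[of q k] unfolding \<theta>[OF int_mem]
      by (simp add: of_int_hyperrat res_carrier_eq)
  qed
  then show "\<theta> ` R = carrier (residue_ring q)"
    using \<theta>.hom_closed by auto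
qed

theorem theorem1p8:
  fixes \<Gamma> :: "('a, 'b) monoid_scheme" and \<Delta> :: "'a set" and p :: nat
  assumes "group \<Gamma>"
    and "infinite (carrier \<Gamma>)"
    and "finitely_generated \<Gamma>"
    and "fully_residually_free \<Gamma>"
    and "\<Delta> \<lhd> \<Gamma>"
    and "finite (rcosets\<^bsub>\<Gamma>\<^esub> \<Delta>)"
    and "prime p"
  shows "\<exists>R m \<phi> \<rho>.
    subdomain R (class_ring :: complex ring) \<and>
    ideal m (complex_subring R) \<and>
    \<phi> \<in> ring_iso (complex_subring R Quot m) (residue_ring (int p)) \<and>
    \<rho> \<in> hom \<Gamma> (SL (2 * card (rcosets\<^bsub>\<Gamma>\<^esub> \<Delta>)) (complex_subring R)) \<and>
    inj_on \<rho> (carrier \<Gamma>) \<and>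
    \<Delta> = kernel \<Gamma> (SL (2 * card (rcosets\<^bsub>\<Gamma>\<^esub> \<Delta>)) (residue_ring (int p)))
          (mat_reduction (complex_subring R) m \<phi> \<circ> \<rho>)"
proof -
  interpret \<Gamma>: group \<Gamma> by fact
  have p: "int p > 1" using assms(7) prime_gt_1_nat[of p] by simp
  obtain \<psi> where \<psi>: "\<And>n. \<exists>r. \<psi> n \<in> hom \<Gamma> (free_group r)"
    and sep: "\<And>g. g \<in> carrier \<Gamma> - {\<one>\<^bsub>\<Gamma>\<^esub>} \<Longrightarrow> eventually (\<lambda>n. \<psi> n g \<noteq> []) sequentially"
    using ex_separating_sequence[OF assms(1-4)] by blast
  have \<psi>_mult: "\<psi> n (g \<otimes>\<^bsub>\<Gamma>\<^esub> h) = foldr push (\<psi> n g) (\<psi> n h)"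
    if "g \<in> carrier \<Gamma>" "h \<in> carrier \<Gamma>" for n g h
    using \<psi>[of n] that by (auto simp: hom_def free_group_def)
  have \<psi>_red: "reduced (\<psi> n g)" if "g \<in> carrier \<Gamma>" for n g
    using \<psi>[of n] that by (auto simp: hom_def free_group_def)
  have \<psi>_one: "\<psi> n \<one>\<^bsub>\<Gamma>\<^esub> = []" for n
  proof -
    obtain r where "\<psi> n \<in> hom \<Gamma> (free_group r)" using \<psi> by blast
    then show ?thesis
      using hom_one[OF _ assms(1) group_free_group, of "\<psi> n" r] by (simp add: free_group_def)
  qed

  \<comment> \<open>The coefficient is divisible by \<open>p\<close> for the reduction and at least five for ping-pong.\<close>
  define c where "c = 5 * int p"
  define \<tau> where "\<tau> = (\<lambda>g. hyper2 (\<lambda>n. word_mat c (\<psi> n g)))"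
  have \<tau>_mult: "\<tau> (g \<otimes>\<^bsub>\<Gamma>\<^esub> h) = mult2 (\<tau> g) (\<tau> h)" if "g \<in> carrier \<Gamma>" "h \<in> carrier \<Gamma>" for g h
    using that by (simp add: \<tau>_def \<psi>_mult word_mat_foldr_push hyper2_mult)
  have \<tau>_one: "\<tau> \<one>\<^bsub>\<Gamma>\<^esub> = one2"
    by (simp add: \<tau>_def \<psi>_one hyper2_one_iff)
  have \<tau>_det: "det2 (\<tau> g) = 1" for g
    by (simp add: \<tau>_def det2_hyper2 det2_word_mat hyper_simps(6))
  have \<tau>_eq_one: "g = \<one>\<^bsub>\<Gamma>\<^esub>" if g: "g \<in> carrier \<Gamma>" "\<tau> g = one2" for g
  proof (rule ccontr)
    assume "g \<noteq> \<one>\<^bsub>\<Gamma>\<^esub>"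
    then have "eventually (\<lambda>n. \<psi> n g \<noteq> []) ultra"
      using sep[of g] g filter_leD[OF ultra_le_sequentially] by simp
    moreover have "eventually (\<lambda>n. word_mat c (\<psi> n g) = one2) ultra"
      using g(2) by (simp add: \<tau>_def hyper2_one_iff)
    ultimately have "eventually (\<lambda>n. False) ultra"
      by eventually_elim (use word_mat_eq_one2D[OF _ \<psi>_red[OF g(1)], of c] p in \<open>simp add: c_def\<close>)
    then show False by (simp add: trivial_limit_def[symmetric])
  qed
  have \<tau>_inj: "inj_on \<tau> (carrier \<Gamma>)"
  proof (rule inj_onI)
    fix g h assume gh: "g \<in> carrier \<Gamma>" "h \<in> carrier \<Gamma>" "\<tau> g = \<tau> h"
    have "\<tau> (g \<otimes>\<^bsub>\<Gamma>\<^esub> inv\<^bsub>\<Gamma>\<^esub> h) = \<tau> (h \<otimes>\<^bsub>\<Gamma>\<^esub> inv\<^bsub>\<Gamma>\<^esub> h)"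
      by (simp only: \<tau>_mult gh \<Gamma>.inv_closed)
    then have "g \<otimes>\<^bsub>\<Gamma>\<^esub> inv\<^bsub>\<Gamma>\<^esub> h = \<one>\<^bsub>\<Gamma>\<^esub>"
      using gh by (intro \<tau>_eq_one) (simp_all add: \<tau>_one)
    then show "g = h" using gh by (metis \<Gamma>.inv_closed \<Gamma>.inv_equality \<Gamma>.inv_inv)
  qed
  have \<tau>_reduct: "map2 (hyper_mod (int p)) (\<tau> g) = one2" for g
  proof -
    have dvd: "int p dvd c" by (simp add: c_def)
    have "fst (word_mat c (\<psi> n g)) mod int p = 1 \<and> fst (snd (word_mat c (\<psi> n g))) mod int p = 0 \<and>
        fst (snd (snd (word_mat c (\<psi> n g)))) mod int p = 0 \<and> snd (snd (snd (word_mat c (\<psi> n g)))) mod int p = 1" for n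
    proof -
      obtain x y z t where M: "word_mat c (\<psi> n g) = (x, y, z, t)" by (metis prod_cases4)
      note d = word_mat_cong[OF dvd M]
      have "x mod int p = 1 mod int p" "t mod int p = 1 mod int p"
        using d(1,4) by (simp_all add: mod_eq_dvd_iff)
      with d(2,3) p M show ?thesis by simp
    qed
    then show ?thesis
      by (auto simp: \<tau>_def hyper2_def one2_def intro!: hyper_mod_eqI)
  qed

  \<comment> \<open>Including the inverses of the generators avoids inverting matrices: the entries at all other
    elements are then sums of products.\<close>
  obtain S where S: "finite S" "S \<subseteq> carrier \<Gamma>" "generate \<Gamma> S = carrier \<Gamma>"
    using assms(3) unfolding finitely_generated_def by blast
  have fin_entries: "finite (entries2 A)" for A :: "hyperrat mat2"
    by (cases A) simp
  obtain K h where K: "subfield_embedding K h"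
    and SK: "(\<Union>s\<in>S \<union> m_inv \<Gamma> ` S. entries2 (\<tau> s)) \<subseteq> K"
    using ex_subfield_embedding[of "\<Union>s\<in>S \<union> m_inv \<Gamma> ` S. entries2 (\<tau> s)"] S(1) fin_entries by auto
  interpret K: subfield_embedding K h by fact
  have \<tau>_K: "entries2 (\<tau> g) \<subseteq> K" if "g \<in> carrier \<Gamma>" for g
    using that unfolding S(3)[symmetric]
  proof induction
    case one
    show ?case by (simp add: \<tau>_one one2_def K.zero_mem K.one_mem)
  next
    case (eng g g')
    have "\<tau> (g \<otimes>\<^bsub>\<Gamma>\<^esub> g') = mult2 (\<tau> g) (\<tau> g')"
      using eng.hyps S(3) by (intro \<tau>_mult) auto
    then show ?case
      using eng.IH by (cases "\<tau> g"; cases "\<tau> g'") (auto intro!: K.add_mem K.mult_mem)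
  qed (use SK in blast)+

  define R where "R = h ` (K \<inter> range hyper)"
  define \<theta> where "\<theta> = (\<lambda>z. hyper_mod (int p) (inv_into K h z))"
  note residue = hyper_image_residue_hom[OF K p, folded R_def \<theta>_def]
  define \<sigma> where "\<sigma> = (\<lambda>g. map2 h (\<tau> g))"
  have \<sigma>_entries: "entries2 (\<sigma> g) \<subseteq> R" if "g \<in> carrier \<Gamma>" for g
  proof -
    have "entries2 (\<tau> g) \<subseteq> range hyper" unfolding \<tau>_def by (rule entries2_hyper2)
    then show ?thesis using \<tau>_K[OF that] by (cases "\<tau> g") (auto simp: \<sigma>_def R_def)
  qed
  have \<sigma>_reduct: "map2 \<theta> (\<sigma> g) = one2" if "g \<in> carrier \<Gamma>" for g
    using \<tau>_K[OF that] \<tau>_reduct[of g] by (cases "\<tau> g") (simp add: \<sigma>_def \<theta>_def K.inj_on_h)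
  have \<sigma>_det: "det2 (\<sigma> g) = 1" if "g \<in> carrier \<Gamma>" for g
    using \<tau>_K[OF that] \<tau>_det[of g]
    by (cases "\<tau> g") (simp add: \<sigma>_def K.mult_mem K.h_one flip: K.h_mult K.h_diff)
  have \<sigma>_mult: "\<sigma> (g \<otimes>\<^bsub>\<Gamma>\<^esub> g') = mult2 (\<sigma> g) (\<sigma> g')" if "g \<in> carrier \<Gamma>" "g' \<in> carrier \<Gamma>" for g g'
    using \<tau>_K[OF that(1)] \<tau>_K[OF that(2)]
    by (cases "\<tau> g"; cases "\<tau> g'") (simp add: \<sigma>_def \<tau>_mult[OF that] K.mult_mem K.h_add K.h_mult)
  have \<sigma>_inj: "inj_on \<sigma> (carrier \<Gamma>)"
  proof (rule inj_onI)
    fix g g' assume gg': "g \<in> carrier \<Gamma>" "g' \<in> carrier \<Gamma>" "\<sigma> g = \<sigma> g'"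
    then have "\<tau> g = \<tau> g'"
      using \<tau>_K[OF gg'(1)] \<tau>_K[OF gg'(2)]
      by (cases "\<tau> g"; cases "\<tau> g'") (auto simp: \<sigma>_def inj_on_eq_iff[OF K.inj_on_h])
    then show "g = g'" using \<tau>_inj gg' by (auto dest: inj_onD)
  qed
  show ?thesis
    by (rule exE[OF ex_rep_with_reduction_kernel[OF assms(1,5,6) residue, of \<sigma>]],
        erule \<sigma>_entries, erule \<sigma>_reduct, erule \<sigma>_det, erule (1) \<sigma>_mult, rule \<sigma>_inj,
        elim exE, (rule exI)+, rule conjI[OF residue(1)], assumption)
qed

end
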